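(* There exists a crystalline measure on $\mathbb{R}$ that is not a Fourier Quasicrystal.
   Context: A set $E\subset\mathbb{R}$ is called discrete if its intersection with any bounded interval (ball) is a finite set. "Complex measure" on $\mathbb{R}$ means a locally finite complex measure (its total variation on $\mathbb{R}$ need not be finite); one with discrete support has the form $\mu=\sum_{\lambda\in\operatorname{supp}\mu}c_\lambda\delta_\lambda$ with $c_\lambda\in\mathbb{C}$, where $\delta_x$ is the unit mass at $x$. $|\mu|$ denotes the positive measure given by the variation of $\mu$ (so $|\mu|=\sum|c_\lambda|\delta_\lambda$ in the discrete case). $S(\mathbb{R})$ is the Schwartz space of test functions and $S^*(\mathbb{R})$ is the space of continuous linear functionals on it (temperate, i.e. tempered, distributions). A measure $\mu$ is a temperate distribution if the functional $\varphi\mapsto\int\varphi\,d\mu$ on $C_c^\infty(\mathbb{R})$ extends to a continuous linear functional on $S(\mathbb{R})$. The Fourier transform of $f\in S^*(\mathbb{R})$ is given by $\hat f(\varphi)=f(\hat\varphi)$ for all $\varphi\in S(\mathbb{R})$, where $\hat\varphi(t)=\int_{\mathbb{R}}\varphi(x)e^{-2\pi i xt}\,dx$. A complex measure $\mu$ on $\mathbb{R}$ with discrete support is called crystalline if $\mu$ is a temperate distribution and its Fourier transform $\hat\mu$ in the sense of distributions is also a measure with discrete support. A crystalline measure $\mu$ is called a Fourier Quasicrystal if the measures $|\mu|$ and $|\hat\mu|$ are also temperate distributions. *)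

theory Defs
  imports "HOL-Analysis.Analysis"
begin

section \<open>Locally finite complex measures on the real line\<close>

text \<open>
  A locally finite complex measure is a countably additive complex set function on the
  bounded Borel sets; its values elsewhere carry no meaning and are never used. Taking all
  \<^term>\<open>A i\<close> empty gives the value 0 on the empty set, and finiteness of the variation on
  bounded sets is automatic.
\<close>

definition complex_measure :: "(real set \<Rightarrow> complex) \<Rightarrow> bool" where
  "complex_measure \<mu> \<longleftrightarrow>
     (\<forall>A :: nat \<Rightarrow> real set.
        (\<forall>i. A i \<in> sets borel) \<and> disjoint_family A \<and> bounded (\<Union>i. A i) \<longrightarrow>
        (\<lambda>i. \<mu> (A i)) sums \<mu> (\<Union>i. A i))"

definition variation :: "(real set \<Rightarrow> complex) \<Rightarrow> real measure" where
  "variation \<mu> = measure_of UNIV (sets borel)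
     (\<lambda>B. SUP P \<in> {P. finite P \<and> disjoint P \<and> (\<forall>A\<in>P. A \<in> sets borel \<and> bounded A \<and> A \<subseteq> B)}.
            \<Sum>A\<in>P. ennreal (norm (\<mu> A)))"

text \<open>The variation, again as a set function on bounded Borel sets.\<close>

definition abs_measure :: "(real set \<Rightarrow> complex) \<Rightarrow> real set \<Rightarrow> complex" where
  "abs_measure \<mu> B = complex_of_real (measure (variation \<mu>) B)"

definition supp_measure :: "(real set \<Rightarrow> complex) \<Rightarrow> real set" where
  "supp_measure \<mu> = {x. \<forall>U. open U \<and> x \<in> U \<longrightarrow> emeasure (variation \<mu>) U \<noteq> 0}"

definition discrete_set :: "real set \<Rightarrow> bool" where
  "discrete_set E \<longleftrightarrow> (\<forall>B. bounded B \<longrightarrow> finite (E \<inter> B))"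

text \<open>
  The positive variation of a real-valued set function. Since \<^term>\<open>ennreal\<close> maps negative
  reals to 0 and the empty set competes in the supremum, no further truncation is needed.
  The integral against a complex measure is taken through the Jordan decompositions of its
  real and imaginary parts; it is only applied to continuous functions of compact support.
\<close>

definition pos_variation :: "(real set \<Rightarrow> real) \<Rightarrow> real measure" where
  "pos_variation \<rho> = measure_of UNIV (sets borel)
     (\<lambda>B. SUP A \<in> {A. A \<in> sets borel \<and> bounded A \<and> A \<subseteq> B}. ennreal (\<rho> A))"

definition complex_integral :: "(real set \<Rightarrow> complex) \<Rightarrow> (real \<Rightarrow> complex) \<Rightarrow> complex" where
  "complex_integral \<mu> \<phi> =
     ((LINT x | pos_variation (\<lambda>A. Re (\<mu> A)). \<phi> x) - (LINT x | pos_variation (\<lambda>A. - Re (\<mu> A)). \<phi> x))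
     + \<i> * ((LINT x | pos_variation (\<lambda>A. Im (\<mu> A)). \<phi> x) - (LINT x | pos_variation (\<lambda>A. - Im (\<mu> A)). \<phi> x))"


section \<open>Schwartz space and temperate distributions\<close>

definition nth_derivative :: "nat \<Rightarrow> (real \<Rightarrow> complex) \<Rightarrow> real \<Rightarrow> complex" where
  "nth_derivative k f = ((\<lambda>g x. vector_derivative g (at x)) ^^ k) f"

definition smooth_function :: "(real \<Rightarrow> complex) \<Rightarrow> bool" where
  "smooth_function f \<longleftrightarrow> (\<forall>k x. nth_derivative k f differentiable at x)"

definition test_functions :: "(real \<Rightarrow> complex) set" where
  "test_functions = {f. smooth_function f \<and> compact (closure {x. f x \<noteq> 0})}"

definition schwartz_space :: "(real \<Rightarrow> complex) set" where
  "schwartz_space = {f. smooth_function f \<and>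
     (\<forall>j k. bounded (range (\<lambda>x. x ^ j *\<^sub>R nth_derivative k f x)))}"

definition schwartz_seminorm :: "nat \<Rightarrow> nat \<Rightarrow> (real \<Rightarrow> complex) \<Rightarrow> real" where
  "schwartz_seminorm j k f = (SUP x. norm (x ^ j *\<^sub>R nth_derivative k f x))"

definition schwartz_topology :: "(real \<Rightarrow> complex) topology" where
  "schwartz_topology = topology_generated_by
     {{g \<in> schwartz_space. schwartz_seminorm j k (\<lambda>x. g x - f x) < \<epsilon>} | j k f \<epsilon>.
        f \<in> schwartz_space \<and> \<epsilon> > 0}"

text \<open>
  Functionals on the Schwartz space are total functions in HOL; only their values on
  \<^term>\<open>schwartz_space\<close>, the carrier of \<^term>\<open>schwartz_topology\<close>, matter.
\<close>

definition temperate_distribution :: "((real \<Rightarrow> complex) \<Rightarrow> complex) \<Rightarrow> bool" where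
  "temperate_distribution T \<longleftrightarrow>
     (\<forall>f\<in>schwartz_space. \<forall>g\<in>schwartz_space. T (\<lambda>x. f x + g x) = T f + T g) \<and>
     (\<forall>c. \<forall>f\<in>schwartz_space. T (\<lambda>x. c * f x) = c * T f) \<and>
     continuous_map schwartz_topology euclidean T"

definition fourier :: "(real \<Rightarrow> complex) \<Rightarrow> real \<Rightarrow> complex" where
  "fourier \<phi> t = (LINT x | lborel. \<phi> x * exp (- (2 * complex_of_real pi * \<i> * complex_of_real (x * t))))"

definition fourier_distribution ::
    "((real \<Rightarrow> complex) \<Rightarrow> complex) \<Rightarrow> (real \<Rightarrow> complex) \<Rightarrow> complex" where
  "fourier_distribution T = (\<lambda>\<phi>. T (fourier \<phi>))"


section \<open>Crystalline measures and Fourier quasicrystals\<close>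

definition given_by_measure :: "((real \<Rightarrow> complex) \<Rightarrow> complex) \<Rightarrow> (real set \<Rightarrow> complex) \<Rightarrow> bool" where
  "given_by_measure T \<mu> \<longleftrightarrow> (\<forall>\<phi>\<in>test_functions. T \<phi> = complex_integral \<mu> \<phi>)"

definition temperate_measure :: "(real set \<Rightarrow> complex) \<Rightarrow> bool" where
  "temperate_measure \<mu> \<longleftrightarrow> (\<exists>T. temperate_distribution T \<and> given_by_measure T \<mu>)"

text \<open>
  \<open>fourier_measure \<mu> \<nu>\<close>: \<open>\<mu>\<close> is a temperate distribution whose Fourier transform is the
  measure \<open>\<nu>\<close>. Test functions being dense in the Schwartz space, the extension \<open>T\<close> is unique,
  and \<open>\<nu>\<close> is determined on bounded Borel sets by \<open>\<mu>\<close>.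
\<close>

definition fourier_measure :: "(real set \<Rightarrow> complex) \<Rightarrow> (real set \<Rightarrow> complex) \<Rightarrow> bool" where
  "fourier_measure \<mu> \<nu> \<longleftrightarrow> complex_measure \<mu> \<and> complex_measure \<nu> \<and>
     (\<exists>T. temperate_distribution T \<and> given_by_measure T \<mu> \<and>
          given_by_measure (fourier_distribution T) \<nu>)"

definition crystalline :: "(real set \<Rightarrow> complex) \<Rightarrow> bool" where
  "crystalline \<mu> \<longleftrightarrow> complex_measure \<mu> \<and> discrete_set (supp_measure \<mu>) \<and>
     (\<exists>\<nu>. fourier_measure \<mu> \<nu> \<and> discrete_set (supp_measure \<nu>))"

definition fourier_quasicrystal :: "(real set \<Rightarrow> complex) \<Rightarrow> bool" where
  "fourier_quasicrystal \<mu> \<longleftrightarrow> crystalline \<mu> \<and> temperate_measure (abs_measure \<mu>) \<and>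
     (\<exists>\<nu>. fourier_measure \<mu> \<nu> \<and> temperate_measure (abs_measure \<nu>))"

end

theory Submission
  imports Defs
begin

text \<open>
  Why a crystalline measure can fail to be a Fourier quasicrystal: the absolute value of a measure
  forgets cancellation, while the Fourier transform does not. A dipole
  \<open>(\<delta>\<^bsub>x + \<epsilon>\<^esub> - \<delta>\<^sub>x) / \<epsilon>\<close> has mass \<open>2 / \<epsilon>\<close>, but as a distribution it is bounded by \<open>sup |\<phi>'|\<close>
  uniformly in \<open>\<epsilon>\<close>. So replace a periodic lattice measure \<open>\<rho>\<^sub>n\<close> with periodic Fourier transform by
  \<open>\<mu>\<^sub>n = \<rho>\<^sub>n * (\<delta>\<^bsub>\<epsilon>\<^esub> - \<delta>\<^sub>0) / \<epsilon>\<close>: its transform is that of \<open>\<rho>\<^sub>n\<close> times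
  \<open>(exp (- 2 \<pi> \<i> \<epsilon> t) - 1) / \<epsilon>\<close>, hence still discrete, and \<open>\<mu>\<^sub>n\<close> is temperate with bounds independent of \<open>\<epsilon>\<close>, however small \<open>\<epsilon>\<close> is.

  The measure is \<open>\<mu> = \<Sum>\<^sub>n \<mu>\<^sub>n\<close>. For the sum and for its transform to stay locally finite, both \<open>\<rho>\<^sub>n\<close> and
  its transform must vanish on \<open>(-n, n)\<close>. Take \<open>h = 4 n\<close> and give the lattice point \<open>k / h\<close> the mass
  \<open>a(k / h)\<close>, where \<open>a\<close> is an exponential sum with frequencies in \<open>[n, h - n]\<close>. By Poisson summation
  (\<open>poisson_summation_shifted\<close>) the transform sits on these frequencies plus \<open>h \<int>\<close>, which avoids
  \<open>(-n, n)\<close>; and \<open>a\<close> vanishes at the finitely many lattice points of \<open>(-n, n)\<close> if it is built from a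
  polynomial with the corresponding roots of unity as zeros (\<open>gapped_trig_poly_exists\<close>). This
  \<open>a\<close> does not vanish at the lattice point \<open>n\<close>, so \<open>|\<mu>|\<close> has an atom of mass
  \<open>|a(n)| / \<epsilon>\<^sub>n\<close> at \<open>n + \<epsilon>\<^sub>n\<close>. Taking \<open>\<epsilon>\<^sub>n\<close> tiny makes these masses grow faster than every power of \<open>n\<close>,
  which no temperate measure allows: test it on translates of a bump function. The \<open>\<epsilon>\<^sub>n\<close> and their
  differences are irrational, so that atoms of different levels cannot cancel at \<open>n + \<epsilon>\<^sub>n\<close>.

  The analytic ingredients are the explicit description of the variation and the integral of a
  measure with discrete support, the Poisson formula for Lipschitz functions of compact support,
  and the comparison of continuity in the Schwartz topology with seminorm bounds.
\<close>

section \<open>Measures with discrete support\<close>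

text \<open>
  Weighted counting measure, transported to the Borel sets because the variation is a measure on those.
\<close>

definition point_masses :: "(real \<Rightarrow> real) \<Rightarrow> real measure" where
  "point_masses w = distr (density (count_space UNIV) (\<lambda>x. ennreal (w x))) borel (\<lambda>x. x)"

lemma sets_point_masses [simp]: "sets (point_masses w) = sets borel"
  and space_point_masses [simp]: "space (point_masses w) = UNIV"
  by (simp_all add: point_masses_def)

lemma emeasure_point_masses:
  assumes "B \<in> sets borel" "finite F" "F \<subseteq> B" "\<And>x. x \<in> B - F \<Longrightarrow> w x = 0" "\<And>x. w x \<ge> 0"
  shows "emeasure (point_masses w) B = ennreal (\<Sum>x\<in>F. w x)"
proof -
  have "emeasure (point_masses w) B = (\<integral>\<^sup>+x. ennreal (w x) * indicator B x \<partial>count_space UNIV)"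
    using assms(1) unfolding point_masses_def
    by (subst emeasure_distr) (auto simp: emeasure_density)
  also have "\<dots> = (\<Sum>x\<in>F. ennreal (w x) * indicator B x)"
    using assms by (intro nn_integral_count_space') (auto simp: indicator_def)
  also have "\<dots> = (\<Sum>x\<in>F. ennreal (w x))"
    using assms(3) by (intro sum.cong) auto
  also have "\<dots> = ennreal (\<Sum>x\<in>F. w x)"
    using assms(5) by (intro sum_ennreal) auto
  finally show ?thesis .
qed

lemma integral_point_masses:
  fixes f :: "real \<Rightarrow> complex"
  assumes "f \<in> borel_measurable borel" "finite F" "\<And>x. x \<notin> F \<Longrightarrow> w x = 0 \<or> f x = 0" "\<And>x. w x \<ge> 0"
  shows "(LINT x | point_masses w. f x) = (\<Sum>x\<in>F. w x *\<^sub>R f x)"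
proof -
  have "(LINT x | point_masses w. f x) = (LINT x | density (count_space UNIV) (\<lambda>x. ennreal (w x)). f x)"
    unfolding point_masses_def using assms(1) by (subst integral_distr) auto
  also have "\<dots> = (LINT x | count_space UNIV. w x *\<^sub>R f x)"
    using assms(4) by (subst integral_density) auto
  also have "\<dots> = (\<Sum>x | x \<in> UNIV \<and> w x *\<^sub>R f x \<noteq> 0. w x *\<^sub>R f x)"
    by (rule lebesgue_integral_count_space_finite_support, rule finite_subset[OF _ assms(2)])
       (use assms(3) in auto)
  also have "\<dots> = (\<Sum>x\<in>F. w x *\<^sub>R f x)"
    using assms(2,3) by (intro sum.mono_neutral_left) auto
  finally show ?thesis .
qed

lemma emeasure_point_masses_bounded:
  assumes "discrete_set S" "\<And>x. x \<notin> S \<Longrightarrow> w x = 0" "\<And>x. w x \<ge> 0" "bounded B" "B \<in> sets borel"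
  shows "emeasure (point_masses w) B = ennreal (\<Sum>x\<in>S \<inter> B. w x)"
  using assms unfolding discrete_set_def by (intro emeasure_point_masses) auto

text \<open>
  Exhausting by the bounded windows \<open>{-n..n}\<close> reduces the mass of an arbitrary Borel set to the
  finitely many atoms in a window.
\<close>

lemma emeasure_point_masses_le:
  assumes S: "discrete_set S" "\<And>x. x \<notin> S \<Longrightarrow> w x = 0" "\<And>x. w x \<ge> 0" and B: "B \<in> sets borel"
    and le: "\<And>F. finite F \<Longrightarrow> F \<subseteq> B \<inter> S \<Longrightarrow> ennreal (\<Sum>x\<in>F. w x) \<le> C"
  shows "emeasure (point_masses w) B \<le> C"
proof -
  define A where "A n = B \<inter> {- real n..real n}" for n
  have A: "range A \<subseteq> sets (point_masses w)" "incseq A" "(\<Union>n. A n) = B"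
  proof -
    show "range A \<subseteq> sets (point_masses w)" using B by (auto simp: A_def)
    show "incseq A" by (auto simp: A_def incseq_def)
    show "(\<Union>n. A n) = B"
    proof safe
      fix x assume "x \<in> B"
      obtain n where "\<bar>x\<bar> \<le> real n" using real_arch_simple by blast
      then show "x \<in> (\<Union>n. A n)" using \<open>x \<in> B\<close> by (auto simp: A_def intro!: exI[of _ n])
    qed (auto simp: A_def)
  qed
  have "emeasure (point_masses w) (A n) \<le> C" for n
  proof -
    have bA: "bounded (A n)" "A n \<in> sets borel"
      using A(1) by (auto simp: A_def intro: bounded_subset[of "{- real n..real n}"])
    have "emeasure (point_masses w) (A n) = ennreal (\<Sum>x\<in>S \<inter> A n. w x)"
      by (rule emeasure_point_masses_bounded[OF S bA])
    also have "\<dots> \<le> C"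
      using S(1) bA by (intro le) (auto simp: A_def discrete_set_def)
    finally show ?thesis .
  qed
  then show ?thesis
    using SUP_emeasure_incseq[OF A(1,2)] A(3) by (metis SUP_least)
qed

lemma borel_measure_of_eqI:
  assumes "sets M = sets borel" "space M = UNIV" "\<And>B. B \<in> sets borel \<Longrightarrow> f B = emeasure M B"
  shows "measure_of UNIV (sets (borel :: real measure)) f = M"
proof -
  have "measure_of UNIV (sets borel) f = measure_of (space M) (sets M) (emeasure M)"
    unfolding assms(1,2)
    by (rule measure_of_eq) (auto simp: assms(3) sets.sigma_sets_eq[of "borel :: real measure", simplified])
  then show ?thesis by (simp add: measure_of_of_measure)
qed

lemma finite_borel: "finite F \<Longrightarrow> F \<in> sets (borel :: real measure)"
  by (simp add: borel_closed finite_imp_closed)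

lemma pos_variation_atomic:
  assumes S: "discrete_set S" and r: "\<And>x. x \<notin> S \<Longrightarrow> r x = 0"
    and \<rho>: "\<And>A. bounded A \<Longrightarrow> A \<in> sets borel \<Longrightarrow> \<rho> A = (\<Sum>x\<in>S \<inter> A. r x)"
  shows "pos_variation \<rho> = point_masses (\<lambda>x. max 0 (r x))"
  unfolding pos_variation_def
proof (rule borel_measure_of_eqI)
  fix B :: "real set" assume B: "B \<in> sets borel"
  let ?w = "\<lambda>x. max 0 (r x)"
  let ?M = "point_masses ?w"
  note w = S r[THEN arg_cong[where f="max 0"], simplified]
  show "(SUP A\<in>{A. A \<in> sets borel \<and> bounded A \<and> A \<subseteq> B}. ennreal (\<rho> A)) = emeasure ?M B"
  proof (rule antisym)
    show "emeasure ?M B \<le> (SUP A\<in>{A. A \<in> sets borel \<and> bounded A \<and> A \<subseteq> B}. ennreal (\<rho> A))"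
    proof (rule emeasure_point_masses_le[OF S _ _ B])
      fix F assume F: "finite F" "F \<subseteq> B \<inter> S"
      \<comment> \<open>only the atoms of positive mass compete for the supremum\<close>
      let ?F = "{x\<in>F. r x > 0}"
      have "(\<Sum>x\<in>F. ?w x) = (\<Sum>x\<in>?F. r x)"
        using F(1) by (intro sum.mono_neutral_cong_right) auto
      also have "\<dots> = \<rho> ?F"
        using F by (subst \<rho>) (auto simp: finite_imp_bounded finite_borel intro!: sum.cong)
      finally show "ennreal (\<Sum>x\<in>F. ?w x) \<le> (SUP A\<in>{A. A \<in> sets borel \<and> bounded A \<and> A \<subseteq> B}. ennreal (\<rho> A))"
        using F by (auto intro!: SUP_upper2[of ?F] simp: finite_imp_bounded finite_borel)
    qed (use r in auto)
    show "(SUP A\<in>{A. A \<in> sets borel \<and> bounded A \<and> A \<subseteq> B}. ennreal (\<rho> A)) \<le> emeasure ?M B"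
    proof (rule SUP_least, safe)
      fix A assume A: "A \<in> sets borel" "bounded A" "A \<subseteq> B"
      have "ennreal (\<rho> A) \<le> ennreal (\<Sum>x\<in>S \<inter> A. ?w x)"
        unfolding \<rho>[OF A(2,1)] by (intro ennreal_leI sum_mono) auto
      also have "\<dots> = emeasure ?M A"
        using A r by (subst emeasure_point_masses_bounded[OF S]) auto
      also have "\<dots> \<le> emeasure ?M B" using A B by (intro emeasure_mono) auto
      finally show "ennreal (\<rho> A) \<le> emeasure ?M B" .
    qed
  qed
qed auto

text \<open>
  Only bounded sets are constrained, because the values of a locally finite complex measure on other
  sets carry no meaning. Points of \<open>S\<close> may have mass 0, which happens where atoms cancel.
\<close>

definition atomic_on :: "real set \<Rightarrow> (real \<Rightarrow> complex) \<Rightarrow> (real set \<Rightarrow> complex) \<Rightarrow> bool" where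
  "atomic_on S c \<mu> \<longleftrightarrow> discrete_set S \<and> (\<forall>x. x \<notin> S \<longrightarrow> c x = 0) \<and>
     (\<forall>A. bounded A \<longrightarrow> A \<in> sets borel \<longrightarrow> \<mu> A = (\<Sum>x\<in>S \<inter> A. c x))"

lemma atomic_onD:
  assumes "atomic_on S c \<mu>"
  shows "discrete_set S" "x \<notin> S \<Longrightarrow> c x = 0"
    "bounded A \<Longrightarrow> A \<in> sets borel \<Longrightarrow> \<mu> A = (\<Sum>x\<in>S \<inter> A. c x)"
    "bounded A \<Longrightarrow> finite (S \<inter> A)"
  using assms by (auto simp: atomic_on_def discrete_set_def)

text \<open>
  Each of the four positive variations keeps the atoms at which the real or imaginary part of the
  mass has the right sign; the parts recombine atom by atom.
\<close>

lemma complex_integral_atomic: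
  assumes \<mu>: "atomic_on S c \<mu>" and \<phi>: "\<phi> \<in> borel_measurable borel"
    and F: "finite F" "\<And>x. x \<in> S - F \<Longrightarrow> \<phi> x = 0"
  shows "complex_integral \<mu> \<phi> = (\<Sum>x\<in>F. c x * \<phi> x)"
proof -
  note \<mu>' = atomic_onD[OF \<mu>]
  have pv: "(LINT x | pos_variation (\<lambda>A. f (\<mu> A)). \<phi> x) = (\<Sum>x\<in>F. max 0 (f (c x)) *\<^sub>R \<phi> x)"
    if f: "linear f" for f :: "complex \<Rightarrow> real"
  proof -
    have "pos_variation (\<lambda>A. f (\<mu> A)) = point_masses (\<lambda>x. max 0 (f (c x)))"
      by (rule pos_variation_atomic[OF \<mu>'(1)]) (simp_all add: \<mu>'(2,3) linear_0[OF f] linear_sum[OF f])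
    moreover have "max 0 (f (c x)) = 0 \<or> \<phi> x = 0" if "x \<notin> F" for x
      using that F(2)[of x] \<mu>'(2)[of x] linear_0[OF f] by (cases "x \<in> S") auto
    ultimately show ?thesis using F(1) \<phi> by (simp only:) (rule integral_point_masses, auto)
  qed
  have pn: "max 0 t *\<^sub>R z - max 0 (- t) *\<^sub>R z = complex_of_real t * z" for t z
    by (auto simp: max_def scaleR_conv_of_real)
  have "complex_integral \<mu> \<phi> =
    (\<Sum>x\<in>F. complex_of_real (Re (c x)) * \<phi> x) + \<i> * (\<Sum>x\<in>F. complex_of_real (Im (c x)) * \<phi> x)"
    unfolding complex_integral_def
    by (subst (1 2 3 4) pv) (auto simp flip: sum_subtractf simp: pn linear_iff)
  also have "\<dots> = (\<Sum>x\<in>F. (of_real (Re (c x)) + \<i> * of_real (Im (c x))) * \<phi> x)"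
    by (simp add: sum_distrib_left ring_distribs sum.distrib mult.assoc)
  finally show ?thesis by (simp flip: complex_eq)
qed

lemma variation_atomic:
  assumes \<mu>: "atomic_on S c \<mu>"
  shows "variation \<mu> = point_masses (\<lambda>x. norm (c x))"
  unfolding variation_def
proof (rule borel_measure_of_eqI)
  fix B :: "real set" assume B: "B \<in> sets borel"
  note \<mu>' = atomic_onD[OF \<mu>]
  let ?M = "point_masses (\<lambda>x. norm (c x))"
  let ?\<P> = "{P. finite P \<and> disjoint P \<and> (\<forall>A\<in>P. A \<in> sets borel \<and> bounded A \<and> A \<subseteq> B)}"
  have M: "emeasure ?M A = ennreal (\<Sum>x\<in>S \<inter> A. norm (c x))" if "bounded A" "A \<in> sets borel" for A
    using that \<mu>' by (intro emeasure_point_masses_bounded) auto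
  show "(SUP P\<in>?\<P>. \<Sum>A\<in>P. ennreal (norm (\<mu> A))) = emeasure ?M B"
  proof (rule antisym)
    show "emeasure ?M B \<le> (SUP P\<in>?\<P>. \<Sum>A\<in>P. ennreal (norm (\<mu> A)))"
    proof (rule emeasure_point_masses_le[OF \<mu>'(1) _ _ B])
      fix F assume F: "finite F" "F \<subseteq> B \<inter> S"
      let ?P = "(\<lambda>x. {x}) ` F"
      have "(\<Sum>A\<in>?P. ennreal (norm (\<mu> A))) = (\<Sum>x\<in>F. ennreal (norm (c x)))"
      proof (subst sum.reindex)
        have "\<mu> {x} = c x" if "x \<in> F" for x
        proof -
          have "S \<inter> {x} = {x}" using that F by auto
          then show ?thesis using \<mu>'(3)[of "{x}"] by simp
        qed
        then show "sum ((\<lambda>A. ennreal (norm (\<mu> A))) \<circ> (\<lambda>x. {x})) F = (\<Sum>x\<in>F. ennreal (norm (c x)))"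
          by (intro sum.cong) auto
      qed (auto simp: inj_on_def)
      then have "ennreal (\<Sum>x\<in>F. norm (c x)) = (\<Sum>A\<in>?P. ennreal (norm (\<mu> A)))"
        by simp
      then show "ennreal (\<Sum>x\<in>F. norm (c x)) \<le> (SUP P\<in>?\<P>. \<Sum>A\<in>P. ennreal (norm (\<mu> A)))"
        using F by (auto intro!: SUP_upper2[of ?P] simp: disjoint_def)
    qed (use \<mu>' in auto)
    show "(SUP P\<in>?\<P>. \<Sum>A\<in>P. ennreal (norm (\<mu> A))) \<le> emeasure ?M B"
    proof (rule SUP_least, safe)
      fix P assume P: "finite P" "disjoint P" "\<forall>A\<in>P. A \<in> sets borel \<and> bounded A \<and> A \<subseteq> B"
      have "(\<Sum>A\<in>P. ennreal (norm (\<mu> A))) \<le> (\<Sum>A\<in>P. emeasure ?M A)"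
        using P(3) by (intro sum_mono) (auto simp: M \<mu>'(3) intro!: ennreal_leI norm_sum)
      also have "\<dots> = emeasure ?M (\<Union>A\<in>P. A)"
        using P by (intro sum_emeasure) (auto simp: disjoint_family_on_def disjoint_def)
      also have "\<dots> \<le> emeasure ?M B" using P B by (intro emeasure_mono) auto
      finally show "(\<Sum>A\<in>P. ennreal (norm (\<mu> A))) \<le> emeasure ?M B" .
    qed
  qed
qed auto

lemma abs_measure_atomic:
  assumes \<mu>: "atomic_on S c \<mu>"
  shows "atomic_on S (\<lambda>x. of_real (norm (c x))) (abs_measure \<mu>)"
proof -
  note \<mu>' = atomic_onD[OF \<mu>]
  have "abs_measure \<mu> A = (\<Sum>x\<in>S \<inter> A. of_real (norm (c x)))" if "bounded A" "A \<in> sets borel" for A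
  proof -
    have "emeasure (variation \<mu>) A = ennreal (\<Sum>x\<in>S \<inter> A. norm (c x))"
      unfolding variation_atomic[OF \<mu>] using that \<mu>' by (intro emeasure_point_masses_bounded) auto
    then show ?thesis by (simp add: abs_measure_def measure_def sum_nonneg)
  qed
  then show ?thesis using \<mu>' by (auto simp: atomic_on_def)
qed

lemma discrete_supp_atomic:
  assumes \<mu>: "atomic_on S c \<mu>"
  shows "discrete_set (supp_measure \<mu>)"
proof -
  note \<mu>' = atomic_onD[OF \<mu>]
  have "supp_measure \<mu> \<subseteq> S"
  proof (rule subsetI, rule ccontr)
    fix x assume x: "x \<in> supp_measure \<mu>" "x \<notin> S"
    let ?U = "ball x 1 - (S \<inter> ball x 1)"
    have "open ?U" using \<mu>'(4)[of "ball x 1"] by (intro open_Diff finite_imp_closed) auto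
    moreover have "emeasure (variation \<mu>) ?U = ennreal (\<Sum>x\<in>{}. norm (c x))"
      unfolding variation_atomic[OF \<mu>] using \<open>open ?U\<close> \<mu>'(2)
      by (intro emeasure_point_masses) auto
    ultimately show False using x by (auto simp: supp_measure_def)
  qed
  then have "supp_measure \<mu> \<inter> B \<subseteq> S \<inter> B" for B by auto
  then show ?thesis using \<mu>'(4) unfolding discrete_set_def by (meson finite_subset)
qed

lemma complex_measure_atomic:
  assumes \<mu>: "atomic_on S c \<mu>"
  shows "complex_measure \<mu>"
  unfolding complex_measure_def
proof (intro allI impI, elim conjE)
  fix A :: "nat \<Rightarrow> real set"
  assume A: "\<forall>i. A i \<in> sets borel" "disjoint_family A" "bounded (\<Union>i. A i)"
  note \<mu>' = atomic_onD[OF \<mu>]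
  let ?F = "S \<inter> (\<Union>i. A i)"
  have fin: "finite ?F" using \<mu>'(4)[OF A(3)] .
  have "(\<lambda>i. \<Sum>x\<in>?F. if x \<in> A i then c x else 0) sums (\<Sum>x\<in>?F. c x)"
  proof (rule sums_sum)
    fix x assume "x \<in> ?F"
    then obtain i where i: "x \<in> A i" by auto
    have "(\<lambda>j. if x \<in> A j then c x else 0) = (\<lambda>j. if j = i then c x else 0)"
      using A(2) i by (fastforce simp: disjoint_family_on_def)
    then show "(\<lambda>j. if x \<in> A j then c x else 0) sums c x"
      using sums_single[of i "\<lambda>_. c x"] by simp
  qed
  moreover have "(\<Sum>x\<in>?F. if x \<in> A i then c x else 0) = \<mu> (A i)" for i
  proof -
    have "bounded (A i)" using A(3) by (rule bounded_subset) auto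
    then have "\<mu> (A i) = (\<Sum>x\<in>S \<inter> A i. c x)" using \<mu>'(3) A(1) by auto
    also have "\<dots> = (\<Sum>x\<in>?F. if x \<in> A i then c x else 0)"
      using fin by (intro sum.mono_neutral_cong_left) auto
    finally show ?thesis ..
  qed
  moreover have "\<mu> (\<Union>i. A i) = (\<Sum>x\<in>?F. c x)" using A by (intro \<mu>'(3)) auto
  ultimately show "(\<lambda>i. \<mu> (A i)) sums \<mu> (\<Union>i. A i)" by simp
qed

text \<open>
  Several indices may share a point: the mass of a point is a sum over a fibre of \<open>p\<close>, and atoms can
  cancel there. Integrals are insensitive to this and may be computed as sums over the indices.
\<close>

definition family_mass :: "'i set \<Rightarrow> ('i \<Rightarrow> real) \<Rightarrow> ('i \<Rightarrow> complex) \<Rightarrow> real \<Rightarrow> complex" where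
  "family_mass I p a x = (\<Sum>i | i \<in> I \<and> p i = x. a i)"

definition family_measure :: "'i set \<Rightarrow> ('i \<Rightarrow> real) \<Rightarrow> ('i \<Rightarrow> complex) \<Rightarrow> real set \<Rightarrow> complex" where
  "family_measure I p a B = (\<Sum>i | i \<in> I \<and> p i \<in> B. a i)"

definition locally_finite_family :: "'i set \<Rightarrow> ('i \<Rightarrow> real) \<Rightarrow> bool" where
  "locally_finite_family I p \<longleftrightarrow> (\<forall>B. bounded B \<longrightarrow> finite {i\<in>I. p i \<in> B})"

lemma atomic_family_measure:
  assumes fin: "locally_finite_family I p"
  shows "atomic_on (p ` I) (family_mass I p a) (family_measure I p a)"
  unfolding atomic_on_def
proof (intro conjI allI impI)
  have f: "finite (p ` I \<inter> B)" if "bounded B" for B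
  proof -
    have "p ` I \<inter> B = p ` {i\<in>I. p i \<in> B}" by auto
    then show ?thesis using fin that by (simp add: locally_finite_family_def)
  qed
  then show "discrete_set (p ` I)" by (simp add: discrete_set_def)
  show "family_mass I p a x = 0" if "x \<notin> p ` I" for x
    using that unfolding family_mass_def by (intro sum.neutral) auto
  fix A :: "real set" assume A: "bounded A"
  have "family_measure I p a A = (\<Sum>x\<in>p ` I \<inter> A. \<Sum>i | i \<in> {i\<in>I. p i \<in> A} \<and> p i = x. a i)"
    unfolding family_measure_def using fin A f
    by (intro sum.group[symmetric]) (auto simp: locally_finite_family_def)
  also have "\<dots> = (\<Sum>x\<in>p ` I \<inter> A. family_mass I p a x)"
    unfolding family_mass_def by (intro sum.cong) auto
  finally show "family_measure I p a A = (\<Sum>x\<in>p ` I \<inter> A. family_mass I p a x)" .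
qed

lemma complex_integral_family:
  assumes fin: "locally_finite_family I p" and \<phi>: "\<phi> \<in> borel_measurable borel"
    and F: "finite F" "\<And>i. i \<in> I - F \<Longrightarrow> \<phi> (p i) = 0" "\<And>i. i \<in> F - I \<Longrightarrow> a i = 0"
  shows "complex_integral (family_measure I p a) \<phi> = (\<Sum>i\<in>F. a i * \<phi> (p i))"
proof -
  let ?J = "{i\<in>I. p i \<in> p ` F}"
  have J: "finite ?J" using fin F(1) by (auto simp: locally_finite_family_def finite_imp_bounded)
  have "complex_integral (family_measure I p a) \<phi> = (\<Sum>x\<in>p ` F. family_mass I p a x * \<phi> x)"
    using F by (intro complex_integral_atomic[OF atomic_family_measure[OF fin] \<phi>]) auto
  also have "\<dots> = (\<Sum>x\<in>p ` F. \<Sum>i | i \<in> ?J \<and> p i = x. a i * \<phi> (p i))"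
  proof (rule sum.cong[OF refl])
    fix x assume "x \<in> p ` F"
    then have "{i. i \<in> ?J \<and> p i = x} = {i. i \<in> I \<and> p i = x}" by auto
    then show "family_mass I p a x * \<phi> x = (\<Sum>i | i \<in> ?J \<and> p i = x. a i * \<phi> (p i))"
      by (auto simp: family_mass_def sum_distrib_right intro!: sum.cong)
  qed
  also have "\<dots> = (\<Sum>i\<in>?J. a i * \<phi> (p i))" using J F(1) by (intro sum.group) auto
  also have "\<dots> = (\<Sum>i\<in>I \<inter> F. a i * \<phi> (p i))" using J F by (intro sum.mono_neutral_right) auto
  also have "\<dots> = (\<Sum>i\<in>F. a i * \<phi> (p i))" using F by (intro sum.mono_neutral_left) auto
  finally show ?thesis .
qed

section \<open>Poisson summation\<close>

text \<open>
  Bessel's inequality: expand the nonnegative integral of \<open>|H - S|\<^sup>2\<close>, where \<open>S\<close> is the partial sum of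
  the orthogonal expansion of \<open>H\<close>. Pointwise bounds make every product integrable.
\<close>

lemma norm_sum_orthonormal_le:
  fixes E :: "nat \<Rightarrow> 'a \<Rightarrow> complex"
  assumes "finite_measure M"
    and E: "\<And>k. E k \<in> borel_measurable M" "\<And>k x. norm (E k x) \<le> 1"
    and orth: "\<And>j k. (LINT x|M. E j x * cnj (E k x)) = (if j = k then 1 else 0)"
    and H: "H \<in> borel_measurable M" "\<And>x. norm (H x) \<le> B"
  shows "(\<Sum>k<n. (norm (LINT x|M. H x * cnj (E k x)))\<^sup>2) \<le> Re (LINT x|M. H x * cnj (H x))"
proof -
  interpret finite_measure M by fact
  define c where "c k = (LINT x|M. H x * cnj (E k x))" for k
  have meas [measurable]: "H \<in> borel_measurable M" "E k \<in> borel_measurable M" for k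
    using E H by auto
  have B0: "B \<ge> 0" using H(2) norm_ge_zero order_trans by blast
  have int: "integrable M (\<lambda>x. f x * cnj (g x))"
    if "f \<in> borel_measurable M" "g \<in> borel_measurable M" "\<And>x. norm (f x) \<le> C" "\<And>x. norm (g x) \<le> D"
    for f g C D
  proof (rule integrable_const_bound[of _ "C * D"])
    show "AE x in M. norm (f x * cnj (g x)) \<le> C * D"
      using that by (auto simp: norm_mult intro!: mult_mono order_trans[OF norm_ge_zero])
    show "(\<lambda>x. f x * cnj (g x)) \<in> borel_measurable M"
      using that(1,2) by (intro borel_measurable_times borel_measurable_continuous_on[where f=cnj] continuous_intros)
  qed
  define S where "S x = (\<Sum>k<n. c k * E k x)" for x
  have iHE: "integrable M (\<lambda>x. H x * cnj (E k x))" and iEE: "integrable M (\<lambda>x. E j x * cnj (E k x))"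
    and iEH: "integrable M (\<lambda>x. E k x * cnj (H x))" and iHH: "integrable M (\<lambda>x. H x * cnj (H x))" for j k
    by (rule int; use E H in auto)+
  have cnj_c: "(LINT x|M. E k x * cnj (H x)) = cnj (c k)" for k
  proof -
    have "(\<lambda>x. E k x * cnj (H x)) = (\<lambda>x. cnj (H x * cnj (E k x)))" by (simp add: mult.commute)
    then show ?thesis by (simp only: c_def Bochner_Integration.integral_cnj)
  qed
  have exp: "(H x - S x) * cnj (H x - S x) = H x * cnj (H x)
      - (\<Sum>k<n. cnj (c k) * (H x * cnj (E k x))) - (\<Sum>k<n. c k * (E k x * cnj (H x)))
      + (\<Sum>j<n. \<Sum>k<n. (c j * cnj (c k)) * (E j x * cnj (E k x)))" for x
  proof -
    have "H x * cnj (S x) = (\<Sum>k<n. cnj (c k) * (H x * cnj (E k x)))"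
      "S x * cnj (H x) = (\<Sum>k<n. c k * (E k x * cnj (H x)))"
      by (simp_all add: S_def sum_distrib_left sum_distrib_right mult_ac)
    moreover have "S x * cnj (S x) = (\<Sum>j<n. \<Sum>k<n. (c j * cnj (c k)) * (E j x * cnj (E k x)))"
      by (simp add: S_def sum_product mult_ac)
    moreover have "(H x - S x) * cnj (H x - S x) =
        H x * cnj (H x) - H x * cnj (S x) - S x * cnj (H x) + S x * cnj (S x)"
      by (simp add: algebra_simps)
    ultimately show ?thesis by simp
  qed
  have "(LINT x|M. (H x - S x) * cnj (H x - S x)) = (LINT x|M. H x * cnj (H x))
      - (\<Sum>k<n. cnj (c k) * c k) - (\<Sum>k<n. c k * cnj (c k))
      + (\<Sum>j<n. \<Sum>k<n. (c j * cnj (c k)) * (if j = k then 1 else 0))"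
    unfolding exp
    by (simp add: iHE iEE iEH iHH cnj_c orth flip: c_def)
  also have "\<dots> = (LINT x|M. H x * cnj (H x)) - (\<Sum>k<n. c k * cnj (c k))"
    by (simp add: mult.commute if_distrib cong: if_cong)
  also have "(\<Sum>k<n. c k * cnj (c k)) = of_real (\<Sum>k<n. (norm (c k))\<^sup>2)"
    by (simp only: of_real_sum complex_norm_square)
  finally have "Re (LINT x|M. (H x - S x) * cnj (H x - S x)) =
      Re (LINT x|M. H x * cnj (H x)) - (\<Sum>k<n. (norm (c k))\<^sup>2)" by simp
  moreover have "(LINT x|M. (H x - S x) * cnj (H x - S x)) = of_real (LINT x|M. (norm (H x - S x))\<^sup>2)"
    by (simp only: integral_complex_of_real[symmetric] complex_norm_square)
  moreover have "(LINT x|M. (norm (H x - S x))\<^sup>2) \<ge> 0" by (rule integral_nonneg_AE) auto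
  ultimately have "(\<Sum>k<n. (norm (c k))\<^sup>2) \<le> Re (LINT x|M. H x * cnj (H x))"
    by (metis Re_complex_of_real diff_ge_0_iff_ge)
  then show ?thesis by (simp only: c_def)
qed

lemma orthonormal_coefficients_tendsto_0:
  fixes E :: "nat \<Rightarrow> 'a \<Rightarrow> complex"
  assumes "finite_measure M"
    and E: "\<And>k. E k \<in> borel_measurable M" "\<And>k x. norm (E k x) \<le> 1"
    and orth: "\<And>j k. (LINT x|M. E j x * cnj (E k x)) = (if j = k then 1 else 0)"
    and H: "H \<in> borel_measurable M" "\<And>x. norm (H x) \<le> B"
  shows "(\<lambda>k. LINT x|M. H x * cnj (E k x)) \<longlonglongrightarrow> 0"
proof -
  have "summable (\<lambda>k. (norm (LINT x|M. H x * cnj (E k x)))\<^sup>2)"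
    using norm_sum_orthonormal_le[OF assms] by (intro summableI_nonneg_bounded) auto
  then have "(\<lambda>k. (norm (LINT x|M. H x * cnj (E k x)))\<^sup>2) \<longlonglongrightarrow> 0"
    by (rule summable_LIMSEQ_zero)
  then have "(\<lambda>k. sqrt ((norm (LINT x|M. H x * cnj (E k x)))\<^sup>2)) \<longlonglongrightarrow> sqrt 0"
    by (rule tendsto_real_sqrt)
  then show ?thesis by (simp add: tendsto_norm_zero_iff)
qed

definition char_e :: "real \<Rightarrow> complex" where
  "char_e x = cis (2 * pi * x)"

lemma char_e_add: "char_e (x + y) = char_e x * char_e y"
  and char_e_0 [simp]: "char_e 0 = 1"
  and norm_char_e [simp]: "norm (char_e x) = 1"
  and cnj_char_e: "cnj (char_e x) = char_e (- x)"
  and char_e_nonzero [simp]: "char_e x \<noteq> 0"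
  by (simp_all add: char_e_def cis_mult ring_distribs cis_cnj)

lemma char_e_int [simp]: "char_e (of_int k) = 1"
  by (simp add: char_e_def complex_eq_iff sin_int_2pin cos_int_2pin)

lemma char_e_power: "char_e x ^ n = char_e (real n * x)"
  by (simp add: char_e_def Complex.DeMoivre mult_ac)

lemma char_e_eq_exp: "char_e x = exp (\<i> * of_real (2 * pi * x))"
  by (simp add: char_e_def cis_conv_exp)

lemma norm_char_e_minus_1: "norm (char_e x - 1) = 2 * \<bar>sin (pi * x)\<bar>"
  unfolding char_e_eq_exp dist_exp_i_1 by simp

lemma norm_char_e_minus_1_le: "norm (char_e x - 1) \<le> 2 * pi * \<bar>x\<bar>"
  unfolding norm_char_e_minus_1 using abs_sin_x_le_abs_x[of "pi * x"] by (simp add: abs_mult)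

lemma continuous_on_char_e [continuous_intros]:
  "continuous_on A f \<Longrightarrow> continuous_on A (\<lambda>x. char_e (f x))"
  unfolding char_e_def by (intro continuous_intros)

lemma measurable_char_e [measurable]: "char_e \<in> borel_measurable borel"
  by (intro borel_measurable_continuous_onI continuous_intros)

lemma has_vector_derivative_char_e:
  "((\<lambda>x. char_e (a * x)) has_vector_derivative (2 * pi * \<i> * a * char_e (a * x))) (at x within S)"
proof -
  have "((\<lambda>z. exp (2 * pi * \<i> * a * z)) has_field_derivative 2 * pi * \<i> * a * char_e (a * x)) (at (of_real x))"
    by (auto intro!: derivative_eq_intros simp: char_e_eq_exp mult_ac)
  from has_vector_derivative_real_field[OF this, of S] show ?thesis
    by (simp add: char_e_eq_exp mult_ac)
qed

lemma fourier_char_e: "fourier \<phi> t = (LINT x|lborel. \<phi> x * char_e (- (t * x)))"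
  unfolding fourier_def char_e_eq_exp by (simp add: mult_ac)

abbreviation unit_interval :: "real measure" where
  "unit_interval \<equiv> restrict_space lborel {0..<1}"

lemma finite_measure_unit_interval: "finite_measure unit_interval"
  by (intro finite_measureI) (simp add: emeasure_restrict_space space_restrict_space)

lemma integral_char_e_unit_interval:
  "(LINT x|unit_interval. char_e (of_int k * x)) = (if k = 0 then 1 else 0)"
proof (cases "k = 0")
  case False
  let ?F = "\<lambda>x. char_e (of_int k * x) / (2 * pi * \<i> * k)"
  have "(LINT x|unit_interval. char_e (of_int k * x)) =
      (LINT x|lborel. indicator {0..<1} x *\<^sub>R char_e (of_int k * x))"
    by (rule integral_restrict_space) simp
  also have "\<dots> = (LINT x|lborel. indicator {0..1} x *\<^sub>R char_e (of_int k * x))"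
    by (intro integral_cong_AE eventually_mono[OF AE_lborel_singleton[of 1]])
       (auto simp: indicator_def)
  also have "\<dots> = ?F 1 - ?F 0"
  proof (rule integral_FTC_Icc)
    fix x :: real
    show "(?F has_vector_derivative char_e (of_int k * x)) (at x within {0..1})"
      using has_vector_derivative_divide[OF has_vector_derivative_char_e[of "of_int k" x "{0..1}"], of "2 * pi * \<i> * k"]
      using False by simp
  qed (auto intro!: continuous_intros)
  finally show ?thesis using False by simp
next
  case True
  have "measure unit_interval {0..<1} = 1"
    by (simp add: measure_restrict_space)
  then show ?thesis using True by (simp add: space_restrict_space)
qed

lemma sin_pi_lower_bound:
  assumes "0 \<le> x" "x \<le> 1/2"
  shows "2 * x \<le> sin (pi * x)"
proof -
  have "convex_on {0..pi} (\<lambda>x. - sin x)"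
    by (rule f''_ge0_imp_convex[where f' = "\<lambda>x. - cos x" and f'' = sin])
       (auto intro!: derivative_eq_intros sin_ge_zero)
  from convex_onD[OF this, of "2 * x" 0 "pi / 2"] show ?thesis
    using assms by (simp add: mult_ac)
qed

lemma norm_char_e_minus_1_ge:
  assumes "0 \<le> x" "x \<le> 1"
  shows "4 * min x (1 - x) \<le> norm (char_e x - 1)"
proof -
  have "2 * min x (1 - x) \<le> sin (pi * x)"
  proof (cases "x \<le> 1/2")
    case False
    have "sin (pi * x) = sin (pi * (1 - x))" by (simp add: ring_distribs)
    then show ?thesis using sin_pi_lower_bound[of "1 - x"] False assms by simp
  qed (use sin_pi_lower_bound[of x] assms in simp)
  then show ?thesis unfolding norm_char_e_minus_1 by simp
qed

text \<open>
  Chernoff's argument: dividing \<open>G - G 0\<close> by \<open>e\<^sup>2\<^sup>\<pi>\<^sup>i\<^sup>x - 1\<close> turns the Fourier partial sums into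
  telescoping differences of Fourier coefficients of a bounded function, and these tend to 0.
\<close>

lemma fourier_series_at_0:
  fixes G :: "real \<Rightarrow> complex"
  assumes lip: "\<And>x y. x \<in> {0..1} \<Longrightarrow> y \<in> {0..1} \<Longrightarrow> norm (G x - G y) \<le> L * \<bar>x - y\<bar>"
    and G01: "G 0 = G 1" and G [measurable]: "G \<in> borel_measurable borel"
  defines "c \<equiv> \<lambda>k::int. LINT x|unit_interval. G x * char_e (- (of_int k * x))"
  shows "(\<lambda>i. c (int i) + c (- int i - 1)) sums G 0"
proof -
  interpret finite_measure unit_interval by (rule finite_measure_unit_interval)
  define H where "H x = (if x \<in> {0..<1} then (G x - G 0) / (char_e x - 1) else 0)" for x
  define Hh where "Hh k = (LINT x|unit_interval. H x * char_e (- (of_int k * x)))" for k :: int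
  have L0: "L \<ge> 0" using lip[of 0 1] norm_ge_zero[of "G 0 - G 1"] by (simp del: norm_ge_zero)
  have G0: "norm (G x - G 0) \<le> L * min x (1 - x)" if "x \<in> {0..1}" for x
    using lip[of x 0] lip[of x 1] that G01 by (auto simp: min_def abs_if split: if_splits)
  have Hm [measurable]: "H \<in> borel_measurable borel" unfolding H_def by measurable
  have nz: "char_e x \<noteq> 1" if "x \<in> {0<..<1}" for x
    using norm_char_e_minus_1_ge[of x] that by (auto simp: min_def split: if_splits)
  have Hb: "norm (H x) \<le> L" for x
  proof (cases "x \<in> {0<..<1}")
    case True
    have "norm (G x - G 0) \<le> L * (4 * min x (1 - x))"
      using G0[of x] True L0 by (intro order_trans[OF G0] mult_left_mono) auto
    also have "\<dots> \<le> L * norm (char_e x - 1)"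
      using norm_char_e_minus_1_ge[of x] True L0 by (intro mult_left_mono) auto
    finally show ?thesis using True nz[OF True] by (auto simp: H_def norm_divide divide_le_eq)
  next
    case False
    then show ?thesis using L0 by (auto simp: H_def)
  qed
  have GH: "G x - G 0 = H x * char_e x - H x" if "x \<in> {0..<1}" for x
  proof (cases "x = 0")
    case False
    then have "G x - G 0 = H x * (char_e x - 1)" using nz[of x] that by (simp add: H_def)
    then show ?thesis by (simp add: ring_distribs)
  qed (simp add: H_def)
  have intH: "integrable unit_interval (\<lambda>x. H x * char_e (- (t * x)))" for t
    by (rule integrable_const_bound[of _ L])
       (auto simp: norm_mult Hb intro!: measurable_restrict_space1)
  have intc: "integrable unit_interval (\<lambda>x. G 0 * char_e (- (t * x)))" for t
    by (rule integrable_const_bound[of _ "norm (G 0)"])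
       (auto simp: norm_mult intro!: measurable_restrict_space1)
  have c: "c k = G 0 * (if k = 0 then 1 else 0) + (Hh (k - 1) - Hh k)" for k
  proof -
    have "c k = (LINT x|unit_interval. G 0 * char_e (- (of_int k * x)) +
        (H x * char_e (- (of_int (k - 1) * x)) - H x * char_e (- (of_int k * x))))"
      unfolding c_def
    proof (rule Bochner_Integration.integral_cong[OF refl])
      fix x assume "x \<in> space unit_interval"
      then have "x \<in> {0..<1}" by (simp add: space_restrict_space)
      have "char_e (- (of_int (k - 1) * x)) = char_e x * char_e (- (of_int k * x))"
        by (simp add: algebra_simps flip: char_e_add)
      then show "G x * char_e (- (of_int k * x)) = G 0 * char_e (- (of_int k * x)) +
        (H x * char_e (- (of_int (k - 1) * x)) - H x * char_e (- (of_int k * x)))"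
        using arg_cong[OF GH[OF \<open>x \<in> {0..<1}\<close>], of "\<lambda>z. z * char_e (- (of_int k * x))"]
        by (simp only: left_diff_distrib mult.assoc) (simp add: diff_eq_eq)
    qed
    also have "\<dots> = G 0 * (LINT x|unit_interval. char_e (of_int (- k) * x)) + (Hh (k - 1) - Hh k)"
      unfolding Hh_def using intH[of "of_int (k - 1)"] intH[of "of_int k"] intc[of "of_int k"] by simp
    finally show ?thesis unfolding integral_char_e_unit_interval by simp
  qed
  have part: "(\<Sum>i<Suc n. c (int i) + c (- int i - 1)) = G 0 + (Hh (- int n - 2) - Hh (int n))" for n
    by (induction n) (simp_all add: c algebra_simps)
  have to0: "(\<lambda>n. Hh (int n)) \<longlonglongrightarrow> 0" "(\<lambda>n. Hh (- int n)) \<longlonglongrightarrow> 0"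
  proof -
    have "(\<lambda>n. LINT x|unit_interval. H x * cnj (char_e (s * (real n * x)))) \<longlonglongrightarrow> 0"
      if "s = 1 \<or> s = -1" for s :: real
    proof (rule orthonormal_coefficients_tendsto_0[OF finite_measure_unit_interval])
      fix j k :: nat
      have "(LINT x|unit_interval. char_e (s * (real j * x)) * cnj (char_e (s * (real k * x)))) =
        (LINT x|unit_interval. char_e (of_int (if s = 1 then int j - int k else int k - int j) * x))"
        using that by (intro Bochner_Integration.integral_cong) (auto simp: cnj_char_e algebra_simps simp flip: char_e_add)
      then show "(LINT x|unit_interval. char_e (s * (real j * x)) * cnj (char_e (s * (real k * x)))) =
          (if j = k then 1 else 0)"
        unfolding integral_char_e_unit_interval by auto
    qed (auto intro!: measurable_restrict_space1 Hb)
    from this[of 1] this[of "-1"] show "(\<lambda>n. Hh (int n)) \<longlonglongrightarrow> 0" "(\<lambda>n. Hh (- int n)) \<longlonglongrightarrow> 0"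
      by (simp_all add: Hh_def cnj_char_e)
  qed
  from LIMSEQ_ignore_initial_segment[OF to0(2), of 2] 
  have "(\<lambda>n. Hh (- int n - 2)) \<longlonglongrightarrow> 0" by (simp add: algebra_simps)
  then have "(\<lambda>n. \<Sum>i<Suc n. c (int i) + c (- int i - 1)) \<longlonglongrightarrow> G 0 + (0 - 0)"
    unfolding part using to0(1) by (intro tendsto_intros)
  then show ?thesis unfolding sums_def by (subst (asm) filterlim_sequentially_Suc) simp
qed

text \<open>
  Sums over the integers are organised as series pairing \<open>i\<close> with \<open>- i - 1\<close>, which enumerates every
  integer once; the \<open>n\<close>-th partial sum runs over \<open>{-n..<n}\<close>. Only the convergence of these partial
  sums is ever needed, not absolute summability.
\<close>

lemma sums_int_finite:
  fixes f :: "int \<Rightarrow> complex"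
  assumes "finite F" "\<And>k. k \<notin> F \<Longrightarrow> f k = 0"
  shows "(\<lambda>i. f (int i) + f (- int i - 1)) sums (\<Sum>k\<in>F. f k)"
proof -
  have part: "(\<Sum>i<n. f (int i) + f (- int i - 1)) = (\<Sum>k\<in>{- int n..<int n}. f k)" for n
  proof (induction n)
    case (Suc n)
    have "{- int (Suc n)..<int (Suc n)} = insert (int n) (insert (- int n - 1) {- int n..<int n})" by auto
    then show ?case using Suc by simp
  qed simp
  define n where "n = nat (Max (insert 0 (abs ` F)) + 1)"
  have F: "F \<subseteq> {- int n..<int n}"
  proof
    fix k assume "k \<in> F"
    then have "\<bar>k\<bar> \<le> Max (insert 0 (abs ` F))" using \<open>finite F\<close> by (intro Max_ge) auto
    then show "k \<in> {- int n..<int n}" by (auto simp: n_def)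
  qed
  have "(\<lambda>i. f (int i) + f (- int i - 1)) sums (\<Sum>i<n. f (int i) + f (- int i - 1))"
  proof (rule sums_finite)
    fix i assume "i \<notin> {..<n}"
    then have "int i \<notin> F" "- int i - 1 \<notin> F" using F by auto
    then show "f (int i) + f (- int i - 1) = 0" using assms(2) by simp
  qed simp
  also have "(\<Sum>i<n. f (int i) + f (- int i - 1)) = (\<Sum>k\<in>F. f k)"
    unfolding part using F assms by (intro sum.mono_neutral_right) auto
  finally show ?thesis .
qed

text \<open>
  The values of the Fourier transform at the integers are the Fourier coefficients of the
  periodization of \<open>g\<close>, whose Fourier series at 0 converges by \<open>fourier_series_at_0\<close>. A finite sum
  over translates suffices on \<open>[0, 1]\<close> because of the compact support; it takes in one translate more
  on either side, so that its values at 0 and at 1 both see all integers in the support.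
\<close>

lemma poisson_summation:
  fixes g :: "real \<Rightarrow> complex"
  assumes lip: "\<And>x y. norm (g x - g y) \<le> L * \<bar>x - y\<bar>"
    and supp: "\<And>x. \<bar>x\<bar> > real R \<Longrightarrow> g x = 0"
  shows "(\<lambda>i. fourier g (of_int (int i)) + fourier g (of_int (- int i - 1))) sums
           (\<Sum>m\<in>{- int R..int R}. g (of_int m))"
proof -
  define M where "M = {- int R - 1..int R + 1}"
  define G where "G x = (\<Sum>m\<in>M. g (x + of_int m))" for x
  have L0: "L \<ge> 0" using lip[of 0 1] norm_ge_zero[of "g 0 - g 1"] by (simp del: norm_ge_zero)
  have g0: "g (of_int m) = 0" if "m \<notin> {- int R..int R}" for m
    using that by (intro supp) auto
  have cont: "continuous_on UNIV g"
    by (rule lipschitz_on_continuous_on[of L]) (auto intro!: lipschitz_onI lip L0 simp: dist_norm)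
  have gm [measurable]: "g \<in> borel_measurable borel"
    using cont by (rule borel_measurable_continuous_onI)
  have Gm [measurable]: "G \<in> borel_measurable borel" unfolding G_def by measurable
  have bd: "\<exists>B. \<forall>x. norm (g x) \<le> B"
  proof -
    have "norm (g x) \<le> norm (g 0) + L * real R" for x
    proof (cases "\<bar>x\<bar> > real R")
      case True
      then show ?thesis using supp[of x] L0 by simp
    next
      case False
      have "norm (g x) \<le> norm (g 0) + norm (g x - g 0)" by (rule norm_triangle_sub)
      also have "norm (g x - g 0) \<le> L * \<bar>x - 0\<bar>" by (rule lip)
      also have "\<dots> \<le> L * real R" using False L0 by (intro mult_left_mono) auto
      finally show ?thesis by simp
    qed
    then show ?thesis by blast
  qed
  then obtain B where B: "\<And>x. norm (g x) \<le> B" by blast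
  have coeff: "fourier g (of_int k) = (LINT x|unit_interval. G x * char_e (- (of_int k * x)))" for k
  proof -
    interpret finite_measure unit_interval by (rule finite_measure_unit_interval)
    let ?f = "\<lambda>x. g x * char_e (- (of_int k * x))"
    have int: "integrable lborel (\<lambda>x. indicator {a..<a+1} x *\<^sub>R ?f x)" for a :: real
      by (rule integrableI_bounded_set_indicator[where B=B])
         (auto simp: norm_mult B)
    have "?f x = (\<Sum>m\<in>M. indicator {of_int m..<of_int m + 1} x *\<^sub>R ?f x)" for x
    proof (cases "\<lfloor>x\<rfloor> \<in> M")
      case True
      have "(\<Sum>m\<in>M. indicator {of_int m..<of_int m + 1} x *\<^sub>R ?f x) = (\<Sum>m\<in>M. if m = \<lfloor>x\<rfloor> then ?f x else 0)"
      proof (intro sum.cong refl)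
        fix m
        have "m = \<lfloor>x\<rfloor> \<longleftrightarrow> of_int m \<le> x \<and> x < of_int m + 1" by linarith
        then show "indicator {of_int m..<of_int m + 1} x *\<^sub>R ?f x = (if m = \<lfloor>x\<rfloor> then ?f x else 0)"
          by (simp add: indicator_def)
      qed
      also have "\<dots> = ?f x" using True by (simp add: M_def)
      finally show ?thesis ..
    next
      case False
      then have "\<bar>x\<bar> > real R" by (auto simp: M_def not_le less_floor_iff floor_less_iff le_floor_iff)
      then show ?thesis by (simp add: supp)
    qed
    then have "fourier g (of_int k) = (LINT x|lborel. (\<Sum>m\<in>M. indicator {of_int m..<of_int m + 1} x *\<^sub>R ?f x))"
      unfolding fourier_char_e by simp
    also have "\<dots> = (\<Sum>m\<in>M. LINT x|lborel. indicator {of_int m..<of_int m + 1} x *\<^sub>R ?f x)"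
      using int by (rule Bochner_Integration.integral_sum)
    also have "\<dots> = (\<Sum>m\<in>M. LINT x|unit_interval. g (x + of_int m) * char_e (- (of_int k * x)))"
    proof (rule sum.cong[OF refl])
      fix m
      have per: "?f (of_int m + x) = g (x + of_int m) * char_e (- (of_int k * x))" for x
      proof -
        have "- (of_int k * (of_int m + x)) = of_int (- (k * m)) + - (of_int k * x)"
          by (simp add: algebra_simps)
        then have "char_e (- (of_int k * (of_int m + x))) = char_e (- (of_int k * x))"
          by (simp only: char_e_add char_e_int) simp
        then show ?thesis by (simp add: add.commute)
      qed
      have "(LINT x|lborel. indicator {of_int m..<of_int m + 1} x *\<^sub>R ?f x) =
          (LINT x|lborel. indicator {of_int m..<of_int m + 1} (of_int m + x) *\<^sub>R ?f (of_int m + x))"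
        by (subst lborel_integral_real_affine[of 1 _ "of_int m"]) simp_all
      also have "\<dots> = (LINT x|lborel. indicator {0..<1} x *\<^sub>R (g (x + of_int m) * char_e (- (of_int k * x))))"
        by (intro Bochner_Integration.integral_cong refl arg_cong2[where f=scaleR] per) (auto simp: indicator_def)
      also have "\<dots> = (LINT x|unit_interval. g (x + of_int m) * char_e (- (of_int k * x)))"
        by (rule integral_restrict_space[symmetric]) simp
      finally show "(LINT x|lborel. indicator {of_int m..<of_int m + 1} x *\<^sub>R ?f x) = \<dots>" .
    qed
    also have "\<dots> = (LINT x|unit_interval. (\<Sum>m\<in>M. g (x + of_int m) * char_e (- (of_int k * x))))"
    proof (rule Bochner_Integration.integral_sum[symmetric])
      fix m
      show "integrable unit_interval (\<lambda>x. g (x + of_int m) * char_e (- (of_int k * x)))"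
        by (rule integrable_const_bound[of _ B]) (auto simp: norm_mult B intro!: measurable_restrict_space1)
    qed
    finally show ?thesis by (simp add: G_def sum_distrib_right)
  qed
  have G0: "G 0 = (\<Sum>m\<in>{- int R..int R}. g (of_int m))"
    unfolding G_def M_def using g0 by (intro sum.mono_neutral_cong_right) auto
  have "G 1 = (\<Sum>m\<in>(\<lambda>m. m + 1) ` M. g (of_int m))"
    unfolding G_def by (subst sum.reindex) (auto simp: add.commute)
  also have "\<dots> = (\<Sum>m\<in>{- int R..int R}. g (of_int m))"
    unfolding M_def using g0 by (intro sum.mono_neutral_cong_right) auto
  finally have G01: "G 0 = G 1" using G0 by simp
  have "norm (G x - G y) \<le> (real (card M) * L) * \<bar>x - y\<bar>" for x y
  proof -
    have "norm (G x - G y) \<le> (\<Sum>m\<in>M. L * \<bar>x - y\<bar>)"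
      unfolding G_def sum_subtractf[symmetric] 
    proof (rule sum_norm_le)
      fix m
      show "norm (g (x + of_int m) - g (y + of_int m)) \<le> L * \<bar>x - y\<bar>"
        using lip[of "x + of_int m" "y + of_int m"] by simp
    qed
    then show ?thesis by simp
  qed
  from fourier_series_at_0[OF this G01 Gm] show ?thesis
    unfolding coeff G0 .
qed

lemma poisson_summation_shifted:
  fixes \<psi> :: "real \<Rightarrow> complex" and h b :: real
  assumes h: "h > 0" and lip: "\<And>x y. norm (\<psi> x - \<psi> y) \<le> L * \<bar>x - y\<bar>"
    and supp: "\<And>x. \<bar>x\<bar> > R \<Longrightarrow> \<psi> x = 0"
    and F: "finite F" "\<And>m. m \<notin> F \<Longrightarrow> \<psi> (b + h * of_int m) = 0"
  defines "t \<equiv> \<lambda>k::int. char_e (b * (of_int k / h)) * fourier \<psi> (of_int k / h)"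
  shows "(\<lambda>i. t (int i) + t (- int i - 1)) sums (h * (\<Sum>m\<in>F. \<psi> (b + h * of_int m)))"
proof -
  define g where "g x = \<psi> (b + h * x)" for x
  define R' where "R' = nat \<lceil>(\<bar>R\<bar> + \<bar>b\<bar>) / h\<rceil>"
  have supp': "g x = 0" if "\<bar>x\<bar> > real R'" for x
  proof -
    have "(\<bar>R\<bar> + \<bar>b\<bar>) / h \<le> real R'" unfolding R'_def by linarith
    then have "\<bar>R\<bar> + \<bar>b\<bar> < h * \<bar>x\<bar>" using that h by (simp add: field_simps) (smt (verit) mult_less_cancel_left_pos)
    then have "\<bar>h * x\<bar> > \<bar>R\<bar> + \<bar>b\<bar>" using h by (simp add: abs_mult)
    then show ?thesis unfolding g_def by (intro supp) linarith
  qed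
  have "norm (g x - g y) \<le> (L * h) * \<bar>x - y\<bar>" for x y
    using lip[of "b + h * x" "b + h * y"] h by (simp add: g_def abs_mult mult_ac flip: right_diff_distrib)
  from poisson_summation[OF this supp']
  have P: "(\<lambda>i. fourier g (of_int (int i)) + fourier g (of_int (- int i - 1))) sums
      (\<Sum>m\<in>{- int R'..int R'}. g (of_int m))" .
  have "t k = h * fourier g (of_int k)" for k
  proof -
    have "fourier \<psi> (of_int k / h) =
        \<bar>h\<bar> *\<^sub>R (LINT x|lborel. \<psi> (b + h * x) * char_e (- (of_int k / h * (b + h * x))))"
      unfolding fourier_char_e using h by (subst lborel_integral_real_affine[of h _ b]) simp_all
    also have "(\<lambda>x. \<psi> (b + h * x) * char_e (- (of_int k / h * (b + h * x)))) =
        (\<lambda>x. char_e (- (b * (of_int k / h))) * (g x * char_e (- (of_int k * x))))"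
    proof
      fix x
      have "- (of_int k / h * (b + h * x)) = - (b * (of_int k / h)) + - (of_int k * x)"
        using h by (simp add: field_simps)
      then show "\<psi> (b + h * x) * char_e (- (of_int k / h * (b + h * x))) =
          char_e (- (b * (of_int k / h))) * (g x * char_e (- (of_int k * x)))"
        by (simp only: char_e_add g_def mult_ac)
    qed
    finally have "fourier \<psi> (of_int k / h) = h * char_e (- (b * (of_int k / h))) * fourier g (of_int k)"
      using h by (simp add: fourier_char_e scaleR_conv_of_real)
    then show ?thesis unfolding t_def
      using char_e_add[of "b * (of_int k / h)" "- (b * (of_int k / h))"] by (simp add: mult_ac)
  qed
  then have "(\<lambda>i. t (int i) + t (- int i - 1)) sums (h * (\<Sum>m\<in>{- int R'..int R'}. g (of_int m)))"
    using sums_mult[OF P, of "of_real h"] by (simp add: ring_distribs)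
  also have "(\<Sum>m\<in>{- int R'..int R'}. g (of_int m)) = (\<Sum>m\<in>F. \<psi> (b + h * of_int m))"
  proof (rule sum.same_carrierI[of "{- int R'..int R'} \<union> F"])
    show "g (of_int m) = 0" if "m \<in> {- int R'..int R'} \<union> F - {- int R'..int R'}" for m
      using that by (intro supp') auto
    show "\<psi> (b + h * of_int m) = 0" if "m \<in> {- int R'..int R'} \<union> F - F" for m
      using that F(2) by auto
  qed (use F(1) in \<open>auto simp: g_def\<close>)
  finally show ?thesis .
qed

section \<open>Schwartz functions and temperate distributions\<close>

lemma nth_derivative_0 [simp]: "nth_derivative 0 f = f"
  and nth_derivative_Suc: "nth_derivative (Suc k) f x = vector_derivative (nth_derivative k f) (at x)"
  by (simp_all add: nth_derivative_def)

lemma smooth_has_vector_derivative: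
  "smooth_function f \<Longrightarrow> (nth_derivative k f has_vector_derivative nth_derivative (Suc k) f x) (at x)"
  by (simp add: smooth_function_def nth_derivative_Suc vector_derivative_works)

text \<open>
  Exhibiting a whole sequence of successive derivatives identifies them all at once and proves
  smoothness; the rules for differences, multiples, translates and the bump all follow this way.
\<close>

lemma
  assumes "\<And>k x. (D k has_vector_derivative D (Suc k) x) (at x)"
  shows nth_derivative_eqI: "nth_derivative k (D 0) = D k"
    and smooth_functionI: "smooth_function (D 0)"
proof -
  show *: "nth_derivative k (D 0) = D k" for k
  proof (induction k)
    case (Suc k)
    then show ?case
      by (intro ext) (simp only: nth_derivative_Suc vector_derivative_at[OF assms])
  qed simp
  show "smooth_function (D 0)"
    unfolding smooth_function_def * using assms differentiableI_vector by blast
qed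

lemma continuous_on_nth_derivative:
  "smooth_function f \<Longrightarrow> continuous_on A (nth_derivative k f)"
  by (meson continuous_at_imp_continuous_on has_vector_derivative_continuous smooth_has_vector_derivative)

lemma continuous_on_smooth: "smooth_function f \<Longrightarrow> continuous_on A f"
  using continuous_on_nth_derivative[of f A 0] by simp

lemma
  assumes "smooth_function f" "smooth_function g"
  shows nth_derivative_diff: "nth_derivative k (\<lambda>x. f x - g x) = (\<lambda>x. nth_derivative k f x - nth_derivative k g x)"
    and smooth_function_diff: "smooth_function (\<lambda>x. f x - g x)"
proof -
  let ?D = "\<lambda>k x. nth_derivative k f x - nth_derivative k g x"
  have "(?D k has_vector_derivative ?D (Suc k) x) (at x)" for k x
    using assms by (intro has_vector_derivative_diff smooth_has_vector_derivative)
  from nth_derivative_eqI[of ?D, OF this] smooth_functionI[of ?D, OF this]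
  show "nth_derivative k (\<lambda>x. f x - g x) = ?D k" "smooth_function (\<lambda>x. f x - g x)" by simp_all
qed

lemma
  assumes "smooth_function f"
  shows nth_derivative_cmult: "nth_derivative k (\<lambda>x. c * f x) = (\<lambda>x. c * nth_derivative k f x)"
    and smooth_function_cmult: "smooth_function (\<lambda>x. c * f x)"
proof -
  let ?D = "\<lambda>k x. c * nth_derivative k f x"
  have "(?D k has_vector_derivative ?D (Suc k) x) (at x)" for k x
    using assms by (intro has_vector_derivative_mult_right smooth_has_vector_derivative)
  from nth_derivative_eqI[of ?D, OF this] smooth_functionI[of ?D, OF this]
  show "nth_derivative k (\<lambda>x. c * f x) = ?D k" "smooth_function (\<lambda>x. c * f x)" by simp_all
qed

lemma
  assumes "smooth_function f"
  shows nth_derivative_shift: "nth_derivative k (\<lambda>x. f (x - a)) = (\<lambda>x. nth_derivative k f (x - a))"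
    and smooth_function_shift: "smooth_function (\<lambda>x. f (x - a))"
proof -
  let ?D = "\<lambda>k x. nth_derivative k f (x - a)"
  have "(?D k has_vector_derivative ?D (Suc k) x) (at x)" for k x
  proof -
    have "((\<lambda>x. x - a) has_vector_derivative 1) (at x)"
      by (rule has_vector_derivative_eq_rhs[OF has_vector_derivative_diff[OF has_vector_derivative_id has_vector_derivative_const]]) simp
    from vector_diff_chain_at[OF this smooth_has_vector_derivative[OF assms]]
    show ?thesis by (simp add: o_def)
  qed
  from nth_derivative_eqI[of ?D, OF this] smooth_functionI[of ?D, OF this]
  show "nth_derivative k (\<lambda>x. f (x - a)) = ?D k" "smooth_function (\<lambda>x. f (x - a))" by simp_all
qed

lemma schwartz_spaceI:
  assumes "smooth_function f" "\<And>j k. \<exists>C. \<forall>x. norm (x ^ j *\<^sub>R nth_derivative k f x) \<le> C"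
  shows "f \<in> schwartz_space"
  unfolding schwartz_space_def bounded_iff using assms by (auto simp: image_iff) 

lemma schwartz_smooth: "f \<in> schwartz_space \<Longrightarrow> smooth_function f"
  by (simp add: schwartz_space_def)

lemma schwartz_seminorm_upper:
  assumes "f \<in> schwartz_space"
  shows "norm (x ^ j *\<^sub>R nth_derivative k f x) \<le> schwartz_seminorm j k f"
proof -
  have "bounded (range (\<lambda>x. x ^ j *\<^sub>R nth_derivative k f x))"
    using assms by (auto simp: schwartz_space_def)
  then have "bdd_above (range (\<lambda>x. norm (x ^ j *\<^sub>R nth_derivative k f x)))"
    unfolding bounded_iff bdd_above_def by auto
  then show ?thesis unfolding schwartz_seminorm_def by (intro cSUP_upper) auto
qed

lemma schwartz_seminorm_least:
  "(\<And>x. norm (x ^ j *\<^sub>R nth_derivative k f x) \<le> C) \<Longrightarrow> schwartz_seminorm j k f \<le> C"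
  unfolding schwartz_seminorm_def by (intro cSUP_least) auto

lemma schwartz_seminorm_nonneg: "f \<in> schwartz_space \<Longrightarrow> 0 \<le> schwartz_seminorm j k f"
  using schwartz_seminorm_upper[of f 0 j k] norm_ge_zero order_trans by blast

lemma
  assumes f: "f \<in> schwartz_space" and g: "g \<in> schwartz_space"
  shows schwartz_seminorm_diff_le:
      "schwartz_seminorm j k (\<lambda>x. f x - g x) \<le> schwartz_seminorm j k f + schwartz_seminorm j k g"
    and schwartz_space_diff: "(\<lambda>x. f x - g x) \<in> schwartz_space"
proof -
  have le: "norm (x ^ j *\<^sub>R nth_derivative k (\<lambda>x. f x - g x) x) \<le> schwartz_seminorm j k f + schwartz_seminorm j k g"
    for j k x
    unfolding nth_derivative_diff[OF schwartz_smooth[OF f] schwartz_smooth[OF g]] scaleR_diff_right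
    by (intro order_trans[OF norm_triangle_ineq4] add_mono schwartz_seminorm_upper f g)
  then show "schwartz_seminorm j k (\<lambda>x. f x - g x) \<le> schwartz_seminorm j k f + schwartz_seminorm j k g"
    by (intro schwartz_seminorm_least)
  show "(\<lambda>x. f x - g x) \<in> schwartz_space"
    using le smooth_function_diff[OF schwartz_smooth[OF f] schwartz_smooth[OF g]]
    by (intro schwartz_spaceI) blast+
qed

lemma
  assumes f: "f \<in> schwartz_space"
  shows schwartz_seminorm_cmult_le:
      "schwartz_seminorm j k (\<lambda>x. c * f x) \<le> norm c * schwartz_seminorm j k f"
    and schwartz_space_cmult: "(\<lambda>x. c * f x) \<in> schwartz_space"
proof -
  have le: "norm (x ^ j *\<^sub>R nth_derivative k (\<lambda>x. c * f x) x) \<le> norm c * schwartz_seminorm j k f" for j k x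
    using mult_left_mono[OF schwartz_seminorm_upper[OF f, of x j k] norm_ge_zero[of c]]
    by (simp add: nth_derivative_cmult[OF schwartz_smooth[OF f]] norm_mult mult_ac)
  then show "schwartz_seminorm j k (\<lambda>x. c * f x) \<le> norm c * schwartz_seminorm j k f"
    by (intro schwartz_seminorm_least)
  show "(\<lambda>x. c * f x) \<in> schwartz_space"
    using le smooth_function_cmult[OF schwartz_smooth[OF f]] by (intro schwartz_spaceI) blast+
qed

lemma test_functions_smooth: "f \<in> test_functions \<Longrightarrow> smooth_function f"
  by (simp add: test_functions_def)

lemma nth_derivative_eq_0:
  assumes "\<And>x. \<bar>x\<bar> > R \<Longrightarrow> f x = 0" "\<bar>x\<bar> > R"
  shows "nth_derivative k f x = 0"
  using assms(2)
proof (induction k arbitrary: x)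
  case 0
  then show ?case using assms(1)[of x] by simp
next
  case (Suc k)
  have "open {x::real. \<bar>x\<bar> > R}" by (intro open_Collect_less continuous_intros)
  then have "(nth_derivative k f has_vector_derivative 0) (at x)"
    by (rule has_vector_derivative_transform_within_open[OF has_vector_derivative_const]) (use Suc in auto)
  then show ?case by (simp add: nth_derivative_Suc vector_derivative_at)
qed

lemma test_functions_supportE:
  assumes "f \<in> test_functions"
  obtains R where "R > 0" "\<And>x. \<bar>x\<bar> > R \<Longrightarrow> f x = 0"
proof -
  have "bounded (closure {x. f x \<noteq> 0})" using assms by (simp add: test_functions_def compact_imp_bounded)
  then have "bounded {x. f x \<noteq> 0}" using closure_subset bounded_subset by blast
  then obtain R where R: "R > 0" "\<And>x. f x \<noteq> 0 \<Longrightarrow> \<bar>x\<bar> \<le> R"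
    unfolding bounded_pos by auto
  then show thesis using that[of R] by force
qed

lemma test_functions_subset_schwartz: "test_functions \<subseteq> schwartz_space"
proof
  fix f assume f: "f \<in> test_functions"
  obtain R where R: "R > 0" "\<And>x. \<bar>x\<bar> > R \<Longrightarrow> f x = 0"
    by (rule test_functions_supportE[OF f]) blast
  show "f \<in> schwartz_space"
  proof (rule schwartz_spaceI[OF test_functions_smooth[OF f]])
    fix j k
    let ?g = "\<lambda>x. x ^ j *\<^sub>R nth_derivative k f x"
    have "compact (?g ` {-R..R})"
      by (intro compact_continuous_image continuous_intros continuous_on_nth_derivative test_functions_smooth f) simp
    then have "bounded (?g ` {-R..R})" by (rule compact_imp_bounded)
    then obtain C where C: "C > 0" "\<forall>y\<in>?g ` {-R..R}. norm y \<le> C"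
      unfolding bounded_pos by blast
    have "norm (?g x) \<le> C" for x
    proof (cases "\<bar>x\<bar> > R")
      case True
      then show ?thesis using C(1) nth_derivative_eq_0[of R f x k, OF R(2)] by simp
    next
      case False
      then show ?thesis by (intro bspec[OF C(2)] imageI) auto
    qed
    then show "\<exists>C. \<forall>x. norm (?g x) \<le> C" by blast
  qed
qed

lemma topspace_schwartz [simp]: "topspace schwartz_topology = schwartz_space"
  unfolding schwartz_topology_def topology_generated_by_topspace
proof (intro equalityI subsetI)
  fix f assume f: "f \<in> schwartz_space"
  have "schwartz_seminorm 0 0 (\<lambda>x. f x - f x) \<ge> 0" by (intro schwartz_seminorm_nonneg schwartz_space_diff f)
  then show "f \<in> \<Union> {{g \<in> schwartz_space. schwartz_seminorm j k (\<lambda>x. g x - f x) < \<epsilon>} |j k f \<epsilon>.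
               f \<in> schwartz_space \<and> 0 < \<epsilon>}"
    by (intro UnionI[of "{g \<in> schwartz_space. schwartz_seminorm 0 0 (\<lambda>x. g x - f x) < schwartz_seminorm 0 0 (\<lambda>x. f x - f x) + 1}"]
          CollectI exI[of _ 0] exI[of _ f] exI[of _ "schwartz_seminorm 0 0 (\<lambda>x. f x - f x) + 1"])
       (use f in auto)
qed auto

lemma openin_schwartz_ball:
  "f \<in> schwartz_space \<Longrightarrow> \<epsilon> > 0 \<Longrightarrow>
    openin schwartz_topology {g \<in> schwartz_space. schwartz_seminorm j k (\<lambda>x. g x - f x) < \<epsilon>}"
  unfolding schwartz_topology_def by (rule topology_generated_by_Basis) blast

lemma schwartz_seminorm_zero: "schwartz_seminorm j k (\<lambda>x. 0) = 0"
proof -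
  have "nth_derivative k (\<lambda>x. 0) = (\<lambda>x. 0)"
    by (rule nth_derivative_eqI[of "\<lambda>k x. 0"]) simp
  then show ?thesis by (simp add: schwartz_seminorm_def)
qed

lemma schwartz_space_zero: "(\<lambda>x. 0) \<in> schwartz_space"
proof -
  have "nth_derivative k (\<lambda>x. 0) = (\<lambda>x. 0)" for k
    by (rule nth_derivative_eqI[of "\<lambda>k x. 0"]) simp
  then show ?thesis using smooth_functionI[of "\<lambda>k x. 0"] by (intro schwartz_spaceI) auto
qed

text \<open>
  A bound by two seminorms is all that the dipole combs need: they are controlled by \<open>|\<phi>'|\<close> and
  \<open>x\<^sup>2 |\<phi>'|\<close>.
\<close>

lemma temperate_distributionI:
  assumes add: "\<And>f g. f \<in> schwartz_space \<Longrightarrow> g \<in> schwartz_space \<Longrightarrow> T (\<lambda>x. f x + g x) = T f + T g"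
    and cmult: "\<And>c f. f \<in> schwartz_space \<Longrightarrow> T (\<lambda>x. c * f x) = c * T f"
    and bound: "\<And>f. f \<in> schwartz_space \<Longrightarrow>
      norm (T f) \<le> C * (schwartz_seminorm i k f + schwartz_seminorm j l f)"
  shows "temperate_distribution T"
proof -
  have "continuous_map schwartz_topology euclidean T"
    unfolding continuous_map_def
  proof (intro conjI allI impI)
    fix U :: "complex set" assume "openin euclidean U"
    then have U: "open U" by simp
    show "openin schwartz_topology {f \<in> topspace schwartz_topology. T f \<in> U}"
    proof (subst openin_subopen, safe)
      fix f assume f': "f \<in> topspace schwartz_topology" "T f \<in> U"
      then have f: "f \<in> schwartz_space" by simp
      obtain e where e: "e > 0" "ball (T f) e \<subseteq> U" using U f'(2) open_contains_ball by blast
      define D where "D = \<bar>C\<bar> + 1"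
      have D: "D > 0" "C \<le> D" by (auto simp: D_def)
      define \<delta> where "\<delta> = e / (2 * D)"
      have \<delta>: "\<delta> > 0" using e D by (simp add: \<delta>_def)
      let ?V = "\<lambda>i k. {g \<in> schwartz_space. schwartz_seminorm i k (\<lambda>x. g x - f x) < \<delta>}"
      have "T g \<in> U" if g: "g \<in> ?V i k \<inter> ?V j l" for g
      proof -
        let ?d = "\<lambda>x. g x - f x"
        have d: "?d \<in> schwartz_space" using g f by (intro schwartz_space_diff) auto
        have "T g = T f + T ?d" using add[OF f d] by simp
        moreover have "norm (T ?d) < e"
        proof -
          have "norm (T ?d) \<le> C * (schwartz_seminorm i k ?d + schwartz_seminorm j l ?d)" by (rule bound[OF d])
          also have "\<dots> \<le> D * (schwartz_seminorm i k ?d + schwartz_seminorm j l ?d)"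
            using D schwartz_seminorm_nonneg[OF d] by (intro mult_right_mono) (auto intro: add_nonneg_nonneg)
          also have "\<dots> < D * (\<delta> + \<delta>)" using g D by (intro mult_strict_left_mono) auto
          also have "\<dots> = e" using D by (simp add: \<delta>_def field_simps)
          finally show ?thesis .
        qed
        ultimately have "T g \<in> ball (T f) e" by (simp add: dist_norm)
        then show ?thesis using e by auto
      qed
      moreover have "f \<in> ?V i k \<inter> ?V j l"
        using f \<delta> by (simp add: schwartz_seminorm_zero)
      moreover have "openin schwartz_topology (?V i k \<inter> ?V j l)"
        using f \<delta> by (intro openin_Int openin_schwartz_ball)
      ultimately show "\<exists>V. openin schwartz_topology V \<and> f \<in> V \<and> V \<subseteq> {f \<in> topspace schwartz_topology. T f \<in> U}"
        by (intro exI[of _ "?V i k \<inter> ?V j l"]) auto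
    qed
  qed simp
  then show ?thesis using add cmult by (auto simp: temperate_distribution_def)
qed

text \<open>
  The subbasic sets of the Schwartz topology are balls with arbitrary centres for one seminorm; by
  the triangle inequality a neighbourhood of 0 contains a common ball around 0 for finitely many
  seminorms.
\<close>

lemma schwartz_nhd_0:
  assumes "generate_topology_on {{g \<in> schwartz_space. schwartz_seminorm j k (\<lambda>x. g x - f x) < \<epsilon>} | j k f \<epsilon>.
        f \<in> schwartz_space \<and> \<epsilon> > 0} U" "(\<lambda>x. 0) \<in> U"
  shows "\<exists>J \<delta>. \<delta> > 0 \<and> (\<forall>g\<in>schwartz_space. (\<forall>j\<le>J. \<forall>k\<le>J. schwartz_seminorm j k g < \<delta>) \<longrightarrow> g \<in> U)"
  using assms
proof (induction rule: generate_topology_on.induct)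
  case (Int a b)
  then obtain J \<delta> J' \<delta>' where
    "\<delta> > 0" "\<forall>g\<in>schwartz_space. (\<forall>j\<le>J. \<forall>k\<le>J. schwartz_seminorm j k g < \<delta>) \<longrightarrow> g \<in> a"
    "\<delta>' > 0" "\<forall>g\<in>schwartz_space. (\<forall>j\<le>J'. \<forall>k\<le>J'. schwartz_seminorm j k g < \<delta>') \<longrightarrow> g \<in> b"
    by blast
  then show ?case by (intro exI[of _ "max J J'"] exI[of _ "min \<delta> \<delta>'"]) auto
next
  case (UN K)
  then obtain k where k: "k \<in> K" "(\<lambda>x. 0) \<in> k" by blast
  with UN.IH obtain J \<delta> where "\<delta> > 0"
    "\<forall>g\<in>schwartz_space. (\<forall>i\<le>J. \<forall>l\<le>J. schwartz_seminorm i l g < \<delta>) \<longrightarrow> g \<in> k"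
    by meson
  then show ?case using k(1) by (intro exI[of _ J] exI[of _ \<delta>]) auto
next
  case (Basis s)
  then obtain j k f \<epsilon> where s: "s = {g \<in> schwartz_space. schwartz_seminorm j k (\<lambda>x. g x - f x) < \<epsilon>}"
    and f: "f \<in> schwartz_space" by blast
  define \<delta> where "\<delta> = \<epsilon> - schwartz_seminorm j k (\<lambda>x. 0 - f x)"
  have "\<delta> > 0" using Basis s by (simp add: \<delta>_def)
  moreover have "g \<in> s" if g: "g \<in> schwartz_space" "schwartz_seminorm j k g < \<delta>" for g
  proof -
    \<comment> \<open>\<open>g - f = (0 - f) - (0 - g)\<close>, so that the triangle inequality for differences applies\<close>
    have "schwartz_seminorm j k (\<lambda>x. (0 - f x) - (0 - g x)) \<le>
        schwartz_seminorm j k (\<lambda>x. 0 - f x) + schwartz_seminorm j k (\<lambda>x. 0 - g x)"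
      by (intro schwartz_seminorm_diff_le schwartz_space_diff schwartz_space_zero f g)
    moreover have "schwartz_seminorm j k (\<lambda>x. 0 - g x) \<le> schwartz_seminorm j k (\<lambda>x. 0) + schwartz_seminorm j k g"
      by (intro schwartz_seminorm_diff_le schwartz_space_zero g)
    ultimately show ?thesis using g by (simp add: s \<delta>_def schwartz_seminorm_zero)
  qed
  ultimately show ?case by (intro exI[of _ "max j k"] exI[of _ \<delta>]) auto
qed simp

text \<open>
  Homogeneity turns a neighbourhood of 0 on which \<open>|T| < 1\<close> into a bound by finitely many seminorms.
\<close>

lemma temperate_distribution_bound:
  assumes T: "temperate_distribution T"
  obtains J C where "C > 0" "\<And>f B. f \<in> schwartz_space \<Longrightarrow> B > 0 \<Longrightarrow>
    (\<And>j k. j \<le> J \<Longrightarrow> k \<le> J \<Longrightarrow> schwartz_seminorm j k f \<le> B) \<Longrightarrow> norm (T f) \<le> C * B"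
proof -
  have cmult: "\<And>c f. f \<in> schwartz_space \<Longrightarrow> T (\<lambda>x. c * f x) = c * T f"
    using T unfolding temperate_distribution_def by blast
  have T0: "T (\<lambda>x. 0) = 0" using cmult[OF schwartz_space_zero, of 0] by simp
  let ?U = "{f \<in> schwartz_space. T f \<in> ball 0 1}"
  have "openin schwartz_topology ?U"
    using T openin_continuous_map_preimage[of schwartz_topology euclidean T "ball 0 1"]
    by (simp add: temperate_distribution_def del: mem_ball)
  then have "generate_topology_on {{g \<in> schwartz_space. schwartz_seminorm j k (\<lambda>x. g x - f x) < \<epsilon>} | j k f \<epsilon>.
        f \<in> schwartz_space \<and> \<epsilon> > 0} ?U"
    unfolding schwartz_topology_def by (simp add: openin_topology_generated_by_iff)
  note gen = this
  obtain J \<delta> where \<delta>: "\<delta> > 0"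
    "\<And>g. g \<in> schwartz_space \<Longrightarrow> (\<And>j k. j \<le> J \<Longrightarrow> k \<le> J \<Longrightarrow> schwartz_seminorm j k g < \<delta>) \<Longrightarrow> norm (T g) < 1"
  proof -
    have "(\<lambda>x. 0) \<in> ?U" using schwartz_space_zero T0 by simp
    from schwartz_nhd_0[OF gen this] obtain J \<delta> where
      "\<delta> > 0" "\<forall>g\<in>schwartz_space. (\<forall>j\<le>J. \<forall>k\<le>J. schwartz_seminorm j k g < \<delta>) \<longrightarrow> g \<in> ?U"
      by blast
    then show thesis by (intro that[of \<delta> J]) auto
  qed
  show thesis
  proof (rule that[of "2 / \<delta>" J])
    fix f B assume f: "f \<in> schwartz_space" and B: "B > 0"
      "\<And>j k. j \<le> J \<Longrightarrow> k \<le> J \<Longrightarrow> schwartz_seminorm j k f \<le> B"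
    let ?c = "\<delta> / (2 * B)"
    have c: "?c > 0" using \<delta> B by simp
    have "norm (T (\<lambda>x. of_real ?c * f x)) < 1"
    proof (rule \<delta>(2)[OF schwartz_space_cmult[OF f]])
      fix j k assume "j \<le> J" "k \<le> J"
      have "schwartz_seminorm j k (\<lambda>x. of_real ?c * f x) \<le> norm (of_real ?c :: complex) * schwartz_seminorm j k f"
        by (rule schwartz_seminorm_cmult_le[OF f])
      also have "\<dots> \<le> ?c * B" using c B(2)[OF \<open>j \<le> J\<close> \<open>k \<le> J\<close>] unfolding norm_of_real
        by (intro mult_mono schwartz_seminorm_nonneg f) auto
      also have "\<dots> < \<delta>" using B \<delta> by (simp add: field_simps)
      finally show "schwartz_seminorm j k (\<lambda>x. of_real ?c * f x) < \<delta>" .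
    qed
    then have "?c * norm (T f) < 1" using c B(1) \<delta>(1) unfolding cmult[OF f] norm_mult norm_of_real by simp
    then show "norm (T f) \<le> 2 / \<delta> * B" using \<delta> B by (simp add: field_simps)
  qed (use \<delta> in simp)
qed

text \<open>
  The difference quotient decays quadratically, uniformly in \<open>\<epsilon>\<close>. This is what makes dipoles of
  arbitrarily large mass temperate. The constant 3 accounts for the distance at most 1 between \<open>x\<close>
  and the intermediate point of the mean value theorem.
\<close>

lemma schwartz_increment_bound:
  assumes f: "f \<in> schwartz_space" and \<epsilon>: "0 < \<epsilon>" "\<epsilon> \<le> 1"
  shows "norm (f (x + \<epsilon>) - f x) \<le> \<epsilon> * (3 * (schwartz_seminorm 0 1 f + schwartz_seminorm 2 1 f) / (1 + x\<^sup>2))"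
proof -
  let ?S = "schwartz_seminorm 0 1 f + schwartz_seminorm 2 1 f"
  note d = smooth_has_vector_derivative[OF schwartz_smooth[OF f], of 0, simplified, unfolded has_vector_derivative_def]
  obtain \<xi> where \<xi>: "\<xi> \<in> {x<..<x + \<epsilon>}" "norm (f (x + \<epsilon>) - f x) \<le> norm ((x + \<epsilon> - x) *\<^sub>R nth_derivative (Suc 0) f \<xi>)"
    using mvt_general[of x "x + \<epsilon>" f, OF _ _ d] \<epsilon> continuous_on_smooth[OF schwartz_smooth[OF f]] by auto
  have "(1 + \<xi>\<^sup>2) * norm (nth_derivative 1 f \<xi>) \<le> ?S"
    using schwartz_seminorm_upper[OF f, of \<xi> 0 1] schwartz_seminorm_upper[OF f, of \<xi> 2 1]
    by (simp add: ring_distribs)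
  note \<xi>_bound = this
  have x_bound: "1 + x\<^sup>2 \<le> 3 * (1 + \<xi>\<^sup>2)"
  proof -
    have "x\<^sup>2 \<le> 2 * \<xi>\<^sup>2 + 2 * (x - \<xi>)\<^sup>2"
      using zero_le_power2[of "2 * \<xi> - x"] by (simp add: power2_eq_square algebra_simps)
    also have "\<dots> \<le> 2 * \<xi>\<^sup>2 + 2 * 1"
      using \<xi>(1) \<epsilon> by (intro add_left_mono mult_left_mono) (auto simp: abs_square_le_1)
    also have "\<dots> \<le> 3 * \<xi>\<^sup>2 + 2" by simp
    finally show ?thesis by simp
  qed
  have "(1 + x\<^sup>2) * norm (nth_derivative 1 f \<xi>) \<le> 3 * (1 + \<xi>\<^sup>2) * norm (nth_derivative 1 f \<xi>)"
    by (intro mult_right_mono x_bound) simp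
  also have "\<dots> \<le> 3 * ?S" using \<xi>_bound by (simp only: mult.assoc) simp
  finally have "(1 + x\<^sup>2) * norm (nth_derivative 1 f \<xi>) \<le> 3 * ?S" .
  moreover have "1 + x\<^sup>2 > 0" by (simp add: add_pos_nonneg)
  ultimately have "norm (nth_derivative 1 f \<xi>) \<le> 3 * ?S / (1 + x\<^sup>2)"
    by (simp add: pos_le_divide_eq mult.commute)
  then have "\<epsilon> * norm (nth_derivative 1 f \<xi>) \<le> \<epsilon> * (3 * ?S / (1 + x\<^sup>2))"
    using \<epsilon> by (intro mult_left_mono) auto
  then show ?thesis using \<xi>(2) \<epsilon> by (auto intro: order_trans)
qed

lemma test_function_lipschitz:
  assumes f: "f \<in> test_functions"
  obtains L where "\<And>x y. norm (f x - f y) \<le> L * \<bar>x - y\<bar>" "L \<ge> 0"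
proof -
  have s: "f \<in> schwartz_space" using f test_functions_subset_schwartz by auto
  let ?L = "schwartz_seminorm 0 1 f"
  note d = smooth_has_vector_derivative[OF schwartz_smooth[OF s], of 0, simplified, unfolded has_vector_derivative_def]
  have lt: "norm (f y - f x) \<le> ?L * \<bar>y - x\<bar>" if "x < y" for x y
  proof -
    obtain \<xi> where "norm (f y - f x) \<le> norm ((y - x) *\<^sub>R nth_derivative (Suc 0) f \<xi>)"
      using mvt_general[of x y f, OF \<open>x < y\<close> _ d] continuous_on_smooth[OF schwartz_smooth[OF s]] by blast
    also have "\<dots> \<le> \<bar>y - x\<bar> * ?L"
      using schwartz_seminorm_upper[OF s, of \<xi> 0 1] by (simp add: mult_left_mono)
    finally show ?thesis by (simp add: mult.commute)
  qed
  have "norm (f x - f y) \<le> ?L * \<bar>x - y\<bar>" for x y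
    using lt[of x y] lt[of y x] by (cases x y rule: linorder_cases) (auto simp: norm_minus_commute abs_minus_commute)
  then show thesis using that schwartz_seminorm_nonneg[OF s] by blast
qed

section \<open>A smooth bump function\<close>

text \<open>
  Functions \<open>r(x) v\<^sup>m e\<^sup>-\<^sup>v\<close> on \<open>(-1, 1)\<close> with \<open>v = 1 / (1 - x\<^sup>2)\<close>: this family contains the standard
  bump and is closed under differentiation.
\<close>

definition bump_form :: "real poly \<Rightarrow> nat \<Rightarrow> real \<Rightarrow> real" where
  "bump_form r m x = (if \<bar>x\<bar> < 1 then poly r x * (1 / (1 - x\<^sup>2)) ^ m * exp (- (1 / (1 - x\<^sup>2))) else 0)"

definition bump_form_deriv :: "real poly \<Rightarrow> nat \<Rightarrow> real poly" where
  "bump_form_deriv r m =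
     pderiv r * [:1, 0, -1:] ^ 2 + smult (2 * real m) ([:0, 1:] * r * [:1, 0, -1:]) - smult 2 ([:0, 1:] * r)"

text \<open>
  Decay of order two at the end points \<open>\<plusminus>1\<close>, from \<open>v\<^sup>m\<^sup>+\<^sup>2 \<le> (m + 2)! e\<^sup>v\<close>, gives derivative 0 there.
\<close>

lemma bump_form_quadratic_bound:
  assumes "\<bar>a\<bar> = 1"
  obtains C where "\<And>x. \<bar>bump_form r m x\<bar> \<le> C * (x - a)\<^sup>2"
proof -
  have "compact ((\<lambda>x. poly r x) ` {-1..1})" by (intro compact_continuous_image continuous_intros) simp
  then have "bounded ((\<lambda>x. poly r x) ` {-1..1})" by (rule compact_imp_bounded)
  then obtain B where B: "B > 0" "\<And>x. x \<in> {-1..1} \<Longrightarrow> \<bar>poly r x\<bar> \<le> B"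
    unfolding bounded_pos real_norm_def by (metis imageI)
  have "\<bar>bump_form r m x\<bar> \<le> (B * fact (m + 2) * 4) * (x - a)\<^sup>2" for x
  proof (cases "\<bar>x\<bar> < 1")
    case True
    define u where "u = 1 - x\<^sup>2"
    have u: "u > 0" using True by (simp add: u_def abs_square_less_1)
    have "(1 / u) ^ (m + 2) / fact (m + 2) \<le> exp (1 / u)"
    proof -
      have "(1 / u) ^ (m + 2) /\<^sub>R fact (m + 2) \<le> (\<Sum>n. (1 / u) ^ n /\<^sub>R fact n)"
        using sum_le_suminf[OF summable_exp_generic[of "1/u"], of "{m + 2}"] u by simp
      then show ?thesis by (simp add: exp_def divide_inverse mult.commute)
    qed
    then have "(1 / u) ^ (m + 2) \<le> fact (m + 2) * exp (1 / u)"
      by (simp add: pos_divide_le_eq mult.commute del: fact_Suc power_Suc)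
    then have "(1 / u) ^ (m + 2) * exp (- (1 / u)) \<le> fact (m + 2)"
      by (simp add: exp_minus pos_divide_le_eq divide_inverse[symmetric] del: fact_Suc power_Suc)
    then have "(1 / u) ^ (m + 2) * exp (- (1 / u)) * u\<^sup>2 \<le> fact (m + 2) * u\<^sup>2"
      by (rule mult_right_mono) simp
    moreover have "(1 / u) ^ (m + 2) * exp (- (1 / u)) * u\<^sup>2 = (1 / u) ^ m * exp (- (1 / u))"
      using u by (simp add: power2_eq_square)
    ultimately have "(1 / u) ^ m * exp (- (1 / u)) \<le> fact (m + 2) * u\<^sup>2" by simp
    also have "u\<^sup>2 \<le> (2 * \<bar>x - a\<bar>)\<^sup>2"
    proof (rule power_mono)
      have "u = \<bar>x - a\<bar> * \<bar>x + a\<bar>"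
      proof -
        have "a\<^sup>2 = 1" using assms by (metis power2_abs power_one)
        then have "u = - ((x - a) * (x + a))" by (simp add: u_def power2_eq_square algebra_simps)
        then show ?thesis using u by (simp flip: abs_mult)
      qed
      also have "\<dots> \<le> \<bar>x - a\<bar> * 2" using True assms by (intro mult_left_mono) auto
      finally show "u \<le> 2 * \<bar>x - a\<bar>" by simp
    qed (use u in simp)
    finally have *: "(1 / u) ^ m * exp (- (1 / u)) \<le> fact (m + 2) * (4 * (x - a)\<^sup>2)"
      by (simp add: power_mult_distrib)
    have "\<bar>poly r x\<bar> * ((1 / u) ^ m * exp (- (1 / u))) \<le> B * (fact (m + 2) * (4 * (x - a)\<^sup>2))"
    proof (rule mult_mono)
      show "\<bar>poly r x\<bar> \<le> B" using True by (intro B(2)) auto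
    qed (use B u * in auto)
    then show ?thesis using True u by (simp add: bump_form_def abs_mult mult.assoc flip: u_def)
  qed (use B in \<open>simp add: bump_form_def\<close>)
  then show thesis by (rule that)
qed

lemma has_real_derivative_bump_form:
  "(bump_form r m has_real_derivative bump_form (bump_form_deriv r m) (m + 2) x) (at x)"
proof -
  consider "\<bar>x\<bar> < 1" | "\<bar>x\<bar> = 1" | "\<bar>x\<bar> > 1" by linarith
  then show ?thesis
  proof cases
    case 1
    have u: "1 - x\<^sup>2 > 0" using 1 by (simp add: abs_square_less_1)
    define v where "v = 1 / (1 - x\<^sup>2)"
    have v: "v * (1 - x\<^sup>2) = 1" "v > 0" using u by (auto simp: v_def)
    have dv: "((\<lambda>x. 1 / (1 - x\<^sup>2)) has_real_derivative 2 * x * v\<^sup>2) (at x)"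
      using u by (auto intro!: derivative_eq_intros simp: v_def power2_eq_square)
    have "((\<lambda>x. poly r x * (1 / (1 - x\<^sup>2)) ^ m * exp (- (1 / (1 - x\<^sup>2)))) has_real_derivative
       (poly (pderiv r) x * v ^ m + poly r x * (real m * v ^ (m - 1) * (2 * x * v\<^sup>2))) * exp (- v)
        + poly r x * v ^ m * (exp (- v) * (- (2 * x * v\<^sup>2)))) (at x)"
      by (rule derivative_eq_intros poly_DERIV dv refl | simp add: v_def)+
    moreover have "(poly (pderiv r) x * v ^ m + poly r x * (real m * v ^ (m - 1) * (2 * x * v\<^sup>2))) * exp (- v)
        + poly r x * v ^ m * (exp (- v) * (- (2 * x * v\<^sup>2))) =
      poly (bump_form_deriv r m) x * v ^ (m + 2) * exp (- v)"
    proof -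
      have a: "real m * v ^ (m - 1) * v\<^sup>2 = real m * (v ^ (m + 2) * (1 - x\<^sup>2))"
        using v(1) by (cases m) (simp_all add: power2_eq_square mult_ac)
      have b: "v ^ m = v ^ (m + 2) * (1 - x\<^sup>2)\<^sup>2"
      proof -
        have "v ^ (m + 2) * (1 - x\<^sup>2)\<^sup>2 = v ^ m * (v * (1 - x\<^sup>2))\<^sup>2"
          by (simp only: power_add power_mult_distrib mult.assoc)
        then show ?thesis using v(1) by simp
      qed
      have "(poly (pderiv r) x * v ^ m + poly r x * (real m * v ^ (m - 1) * (2 * x * v\<^sup>2))) * exp (- v)
          + poly r x * v ^ m * (exp (- v) * (- (2 * x * v\<^sup>2))) =
        (poly (pderiv r) x * v ^ m + poly r x * 2 * x * (real m * v ^ (m - 1) * v\<^sup>2)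
          - 2 * x * poly r x * (v ^ m * v\<^sup>2)) * exp (- v)"
        by (simp add: algebra_simps)
      also have "\<dots> = (poly (pderiv r) x * (v ^ (m + 2) * (1 - x\<^sup>2)\<^sup>2)
          + poly r x * 2 * x * (real m * (v ^ (m + 2) * (1 - x\<^sup>2)))
          - 2 * x * poly r x * v ^ (m + 2)) * exp (- v)"
        unfolding a b[symmetric] by (simp only: power_add)
      also have "\<dots> = poly (bump_form_deriv r m) x * v ^ (m + 2) * exp (- v)"
        by (simp add: bump_form_deriv_def power2_eq_square[of x]) (simp add: algebra_simps)
      finally show ?thesis .
    qed
    ultimately have "((\<lambda>x. poly r x * (1 / (1 - x\<^sup>2)) ^ m * exp (- (1 / (1 - x\<^sup>2)))) has_real_derivative
        bump_form (bump_form_deriv r m) (m + 2) x) (at x)"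
      using 1 by (simp add: bump_form_def v_def)
    moreover have "open {x::real. \<bar>x\<bar> < 1}" by (intro open_Collect_less continuous_intros)
    ultimately show ?thesis
      using 1 by (elim has_field_derivative_transform_within_open[where S="{x. \<bar>x\<bar> < 1}"]) (auto simp: bump_form_def)
  next
    case 2
    obtain C where C: "\<And>y. \<bar>bump_form r m y\<bar> \<le> C * (y - x)\<^sup>2" by (rule bump_form_quadratic_bound[OF 2]) blast
    have "((\<lambda>h. (bump_form r m (x + h) - bump_form r m x) / h) \<longlongrightarrow> 0) (at 0)"
    proof (rule Lim_null_comparison)
      show "((\<lambda>h. C * \<bar>h\<bar>) \<longlongrightarrow> 0) (at 0)" by (auto intro!: tendsto_eq_intros)
      show "\<forall>\<^sub>F h in at 0. norm ((bump_form r m (x + h) - bump_form r m x) / h) \<le> C * \<bar>h\<bar>"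
      proof (intro eventually_at_filter[THEN iffD2] always_eventually allI impI)
        fix h :: real assume "h \<noteq> 0"
        then show "norm ((bump_form r m (x + h) - bump_form r m x) / h) \<le> C * \<bar>h\<bar>"
          using C[of "x + h"] 2 by (simp add: bump_form_def[of r m x] divide_le_eq power2_eq_square mult.assoc)
      qed
    qed
    then show ?thesis using 2 by (simp add: DERIV_def bump_form_def[of _ "Suc (Suc m)"])
  next
    case 3
    have "((\<lambda>x. 0) has_real_derivative 0) (at x)" by simp
    moreover have "open {x::real. \<bar>x\<bar> > 1}" by (intro open_Collect_less continuous_intros)
    ultimately have "(bump_form r m has_real_derivative 0) (at x)"
      using 3 by (elim has_field_derivative_transform_within_open[where S="{x. \<bar>x\<bar> > 1}"]) (auto simp: bump_form_def)
    then show ?thesis using 3 by (simp add: bump_form_def)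
  qed
qed

definition bump :: "real \<Rightarrow> complex" where
  "bump x = of_real (bump_form 1 0 x)"

lemma smooth_bump: "smooth_function bump"
proof -
  let ?step = "\<lambda>(r, m). (bump_form_deriv r m, m + 2)"
  define D :: "nat \<Rightarrow> real \<Rightarrow> complex"
    where "D k x = of_real (case (?step ^^ k) (1, 0) of (r, m) \<Rightarrow> bump_form r m x)" for k x
  have "(D k has_vector_derivative D (Suc k) x) (at x)" for k x
  proof -
    obtain r m where rm: "(?step ^^ k) (1, 0) = (r, m)" by (cases "(?step ^^ k) (1, 0)")
    have "D k = (\<lambda>x. of_real (bump_form r m x))"
      "D (Suc k) x = of_real (bump_form (bump_form_deriv r m) (m + 2) x)"
      unfolding D_def using rm by simp_all
    then show ?thesis
      using has_vector_derivative_of_real[OF has_real_derivative_bump_form]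
      by metis
  qed
  note D = smooth_functionI[of D, OF this]
  have "D 0 = bump" by (simp add: fun_eq_iff D_def bump_def)
  with D show ?thesis by simp
qed

lemma bump_test: "bump \<in> test_functions"
proof -
  have "{x. bump x \<noteq> 0} \<subseteq> {-1..1}" by (auto simp: bump_def bump_form_def)
  then have "closure {x. bump x \<noteq> 0} \<subseteq> {-1..1}" by (simp add: closure_minimal)
  then have "compact (closure {x. bump x \<noteq> 0})"
    by (meson bounded_closed_interval bounded_subset closed_closure compact_eq_bounded_closed)
  then show ?thesis by (simp add: test_functions_def smooth_bump)
qed

section \<open>Superposed dipole combs\<close>

lemma bounded_realE:
  assumes "bounded (B :: real set)"
  obtains R :: real where "R > 0" "\<And>x. x \<in> B \<Longrightarrow> \<bar>x\<bar> \<le> R"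
  using assms unfolding bounded_pos by auto

lemma summable_inverse_1_plus_square: "summable (\<lambda>i. 1 / (1 + (real i)\<^sup>2))"
proof (rule summable_comparison_test'[of "\<lambda>i. 2 * inverse (real (Suc i) ^ 2)" 0])
  show "summable (\<lambda>i. 2 * inverse (real (Suc i) ^ 2))"
    using inverse_power_summable[of 2, where 'a=real, THEN summable_Suc_iff[THEN iffD2]] by (intro summable_mult) simp
  fix i
  have "(real (Suc i))\<^sup>2 \<le> 2 * (1 + (real i)\<^sup>2)"
    using zero_le_power2[of "real i - 1"] by (simp add: power2_eq_square algebra_simps)
  moreover have pos: "1 + (real i)\<^sup>2 > 0" "(real (Suc i))\<^sup>2 > 0" by (auto simp: add_pos_nonneg)
  ultimately have le: "2 / (2 * (1 + (real i)\<^sup>2)) \<le> 2 / (real (Suc i))\<^sup>2"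
    by (intro divide_left_mono) auto
  have "1 / a = 2 / (2 * a)" for a :: real by simp
  note this[of "1 + (real i)\<^sup>2"]
  also note le
  also have "2 / (real (Suc i))\<^sup>2 = 2 * inverse (real (Suc i) ^ 2)" by (rule divide_inverse)
  finally show "norm (1 / (1 + (real i)\<^sup>2)) \<le> 2 * inverse (real (Suc i) ^ 2)"
    using pos(1) by (simp only: real_norm_def abs_of_pos zero_less_divide_1_iff)
qed

lemma integrable_test_function_char_e:
  assumes "\<phi> \<in> test_functions"
  shows "integrable lborel (\<lambda>y. \<phi> y * char_e (- (t * y)))"
proof -
  obtain R where R: "R > 0" "\<And>x. \<bar>x\<bar> > R \<Longrightarrow> \<phi> x = 0" by (rule test_functions_supportE[OF assms]) blast
  let ?f = "\<lambda>y. \<phi> y * char_e (- (t * y))"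
  have "set_integrable lborel {-R..R} ?f"
    using assms by (intro borel_integrable_atLeastAtMost' continuous_intros continuous_on_smooth test_functions_smooth)
  moreover have "(\<lambda>y. indicator {-R..R} y *\<^sub>R ?f y) = ?f"
    using R(2) by (force simp: indicator_def fun_eq_iff)
  ultimately show ?thesis unfolding set_integrable_def by simp
qed

lemma fourier_increment:
  assumes "\<phi> \<in> test_functions"
  shows "fourier \<phi> (x + a) - fourier \<phi> x = fourier (\<lambda>y. \<phi> y * (char_e (- (a * y)) - 1)) x"
proof -
  have "fourier \<phi> (x + a) - fourier \<phi> x =
      (LINT y|lborel. \<phi> y * char_e (- ((x + a) * y)) - \<phi> y * char_e (- (x * y)))"
    unfolding fourier_char_e using assms
    by (intro Bochner_Integration.integral_diff[symmetric] integrable_test_function_char_e)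
  also have "\<dots> = fourier (\<lambda>y. \<phi> y * (char_e (- (a * y)) - 1)) x"
    unfolding fourier_char_e
  proof (rule Bochner_Integration.integral_cong[OF refl])
    fix y
    have "char_e (- ((x + a) * y)) = char_e (- (x * y)) * char_e (- (a * y))"
      by (simp add: algebra_simps flip: char_e_add)
    then show "\<phi> y * char_e (- ((x + a) * y)) - \<phi> y * char_e (- (x * y)) =
        \<phi> y * (char_e (- (a * y)) - 1) * char_e (- (x * y))"
      by (simp add: algebra_simps)
  qed
  finally show ?thesis .
qed

lemma fourier_divide: "fourier (\<lambda>y. \<psi> y / c) x = fourier \<psi> x / c"
  unfolding fourier_char_e by (simp flip: integral_divide_zero)

lemma norm_char_e_diff_le: "norm (char_e x - char_e y) \<le> 2 * pi * \<bar>x - y\<bar>"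
proof -
  have "char_e x - char_e y = char_e y * (char_e (x - y) - 1)"
    by (simp add: ring_distribs flip: char_e_add)
  then have "norm (char_e x - char_e y) = norm (char_e (x - y) - 1)" by (simp add: norm_mult)
  then show ?thesis using norm_char_e_minus_1_le[of "x - y"] by simp
qed

text \<open>
  Lipschitz continuity is all that the Poisson formula asks for, so the multiplier that represents a
  dipole on the Fourier side requires no calculus of higher derivatives.
\<close>

lemma test_function_mult_lipschitz:
  assumes \<phi>: "\<phi> \<in> test_functions"
  obtains L where "\<And>x y. norm (\<phi> x * (char_e (a * x) - 1) / c - \<phi> y * (char_e (a * y) - 1) / c) \<le> L * \<bar>x - y\<bar>"
proof -
  obtain L where L: "\<And>x y. norm (\<phi> x - \<phi> y) \<le> L * \<bar>x - y\<bar>" "L \<ge> 0"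
    by (rule test_function_lipschitz[OF \<phi>]) blast
  let ?B = "schwartz_seminorm 0 0 \<phi>"
  have s: "\<phi> \<in> schwartz_space" using \<phi> test_functions_subset_schwartz by auto
  have B: "norm (\<phi> x) \<le> ?B" for x using schwartz_seminorm_upper[OF s, of x 0 0] by simp
  have "norm (\<phi> x * (char_e (a * x) - 1) / c - \<phi> y * (char_e (a * y) - 1) / c)
      \<le> ((L * 2 + ?B * (2 * pi * \<bar>a\<bar>)) / norm c) * \<bar>x - y\<bar>" for x y
  proof -
    have "\<phi> x * (char_e (a * x) - 1) - \<phi> y * (char_e (a * y) - 1) =
        (\<phi> x - \<phi> y) * (char_e (a * x) - 1) + \<phi> y * (char_e (a * x) - char_e (a * y))"
      by (simp add: algebra_simps)
    also have "norm \<dots> \<le> norm (\<phi> x - \<phi> y) * norm (char_e (a * x) - 1) + norm (\<phi> y) * norm (char_e (a * x) - char_e (a * y))"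
      by (metis norm_mult norm_triangle_ineq)
    also have "\<dots> \<le> (L * \<bar>x - y\<bar>) * 2 + ?B * (2 * pi * (\<bar>a\<bar> * \<bar>x - y\<bar>))"
    proof (intro add_mono mult_mono)
      show "norm (char_e (a * x) - 1) \<le> 2"
        using norm_triangle_ineq4[of "char_e (a * x)" 1] by simp
      show "norm (char_e (a * x) - char_e (a * y)) \<le> 2 * pi * (\<bar>a\<bar> * \<bar>x - y\<bar>)"
        using norm_char_e_diff_le[of "a * x" "a * y"] by (simp add: abs_mult flip: right_diff_distrib)
    qed (use L B schwartz_seminorm_nonneg[OF s] in auto)
    finally have "norm (\<phi> x * (char_e (a * x) - 1) - \<phi> y * (char_e (a * y) - 1))
      \<le> (L * 2 + ?B * (2 * pi * \<bar>a\<bar>)) * \<bar>x - y\<bar>" by (simp add: algebra_simps)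
    then have "norm (\<phi> x * (char_e (a * x) - 1) - \<phi> y * (char_e (a * y) - 1)) / norm c
      \<le> (L * 2 + ?B * (2 * pi * \<bar>a\<bar>)) * \<bar>x - y\<bar> / norm c" by (rule divide_right_mono) simp
    then show ?thesis by (simp add: norm_divide flip: diff_divide_distrib)
  qed
  then show thesis by (rule that)
qed

definition trig_poly :: "nat \<Rightarrow> (nat \<Rightarrow> complex) \<Rightarrow> (nat \<Rightarrow> real) \<Rightarrow> real \<Rightarrow> complex" where
  "trig_poly d q \<beta> x = (\<Sum>j<d. q j * char_e (\<beta> j * x))"

text \<open>
  Level \<open>n\<close> lives on the lattice \<open>\<int> / h n\<close> and carries at \<open>k / h n\<close> a dipole with amplitude \<open>amp n k\<close> and
  width \<open>\<epsilon> n\<close>. The assumptions \<open>amp_gap\<close> and \<open>freq_gap\<close> open the gap \<open>(-n, n)\<close> in the level and in its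
  Fourier transform, \<open>amp_bound\<close> makes the sum over all levels a temperate distribution, the
  irrationality conditions keep the displaced atoms of different levels apart, and \<open>big_amp\<close>
  makes the masses grow faster than every power. The division by \<open>(h n)\<^sup>2\<close> in \<open>amp_bound\<close> absorbs the passage
  from \<open>1 + (k / h)\<^sup>2\<close> to \<open>1 + k\<^sup>2\<close>.
\<close>

locale dipole_combs =
  fixes h d :: "nat \<Rightarrow> nat" and q :: "nat \<Rightarrow> nat \<Rightarrow> complex" and \<beta> :: "nat \<Rightarrow> nat \<Rightarrow> real"
    and \<epsilon> :: "nat \<Rightarrow> real" and amp :: "nat \<Rightarrow> int \<Rightarrow> complex"
  defines "amp \<equiv> \<lambda>n k. trig_poly (d n) (q n) (\<beta> n) (of_int k / h n)"
  assumes h_pos: "h n > 0"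
    and freq_gap: "j < d n \<Longrightarrow> real n \<le> \<beta> n j \<and> \<beta> n j \<le> real (h n) - real n"
    and amp_gap: "\<bar>k\<bar> < int n * int (h n) \<Longrightarrow> amp n k = 0"
    and amp_bound: "norm (amp n k) \<le> (1/2) ^ n / (real (h n))\<^sup>2"
    and \<epsilon>_pos: "0 < \<epsilon> n" and \<epsilon>_le_1: "\<epsilon> n \<le> 1"
    and \<epsilon>_irrational: "\<epsilon> n \<notin> \<rat>" "m \<noteq> n \<Longrightarrow> \<epsilon> m - \<epsilon> n \<notin> \<rat>"
    and big_amp: "real n * (real n + 2) ^ n \<le> norm (amp n (int n * int (h n))) / \<epsilon> n"
begin

definition dipole :: "nat \<Rightarrow> (real \<Rightarrow> complex) \<Rightarrow> int \<Rightarrow> complex" where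
  "dipole n f k = amp n k * ((f (of_int k / h n + \<epsilon> n) - f (of_int k / h n)) / of_real (\<epsilon> n))"

definition comb :: "nat \<Rightarrow> (real \<Rightarrow> complex) \<Rightarrow> complex" where
  "comb n f = (\<Sum>i. dipole n f (int i) + dipole n f (- int i - 1))"

definition dipole_dist :: "(real \<Rightarrow> complex) \<Rightarrow> complex" where
  "dipole_dist f = (\<Sum>n. comb n f)"

text \<open>
  The two points of each dipole are told apart by a flag, true for the displaced one. Below, each
  level of the Fourier transform is indexed by a frequency \<open>j\<close> and a period \<open>m\<close>.
\<close>

definition atoms :: "(nat \<times> int \<times> bool) set" where
  "atoms = {(n, k, s). \<bar>k\<bar> \<ge> int n * int (h n)}"

definition pos :: "nat \<times> int \<times> bool \<Rightarrow> real" where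
  "pos = (\<lambda>(n, k, s). of_int k / h n + (if s then \<epsilon> n else 0))"

definition wt :: "nat \<times> int \<times> bool \<Rightarrow> complex" where
  "wt = (\<lambda>(n, k, s). (if s then 1 else - 1) * (amp n k / of_real (\<epsilon> n)))"

definition freqs :: "(nat \<times> nat \<times> int) set" where
  "freqs = {(n, j, m). j < d n}"

definition fpos :: "nat \<times> nat \<times> int \<Rightarrow> real" where
  "fpos = (\<lambda>(n, j, m). \<beta> n j + real (h n) * of_int m)"

definition fwt :: "nat \<times> nat \<times> int \<Rightarrow> complex" where
  "fwt = (\<lambda>(n, j, m). of_nat (h n) * q n j * ((char_e (- (\<epsilon> n * fpos (n, j, m))) - 1) / of_real (\<epsilon> n)))"

lemma h_ge_1: "real (h n) \<ge> 1" using h_pos[of n] by simp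

text \<open>
  The two reasons for local finiteness: a level beyond \<open>R + 1\<close> has no atoms in \<open>[-R, R]\<close>, by its gap,
  and each single level has only finitely many. The summand 1 is a bound for the displacement.
\<close>

lemma
  assumes "R > 0"
  shows pos_far: "\<lbrakk>(n, k, s) \<in> atoms; real n > R + 1\<rbrakk> \<Longrightarrow> \<bar>pos (n, k, s)\<bar> > R"
    and pos_far': "\<bar>of_int k\<bar> > (R + 1) * real (h n) \<Longrightarrow> \<bar>pos (n, k, s)\<bar> > R"
proof -
  have *: "\<bar>pos (n, k, s)\<bar> \<ge> \<bar>of_int k / real (h n)\<bar> - 1" for k s
    using \<epsilon>_pos[of n] \<epsilon>_le_1[of n] by (auto simp: pos_def)
  show "\<bar>pos (n, k, s)\<bar> > R" if "\<bar>of_int k\<bar> > (R + 1) * real (h n)"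
  proof -
    have "R + 1 < \<bar>of_int k / real (h n)\<bar>" using that h_pos[of n] by (simp add: pos_less_divide_eq)
    then show ?thesis using *[of k s] by linarith
  qed
  show "\<bar>pos (n, k, s)\<bar> > R" if "(n, k, s) \<in> atoms" "real n > R + 1"
  proof -
    have "real n * real (h n) \<le> \<bar>of_int k\<bar>"
    proof -
      have "real_of_int (int n * int (h n)) \<le> real_of_int \<bar>k\<bar>"
        using that(1) unfolding of_int_le_iff by (simp add: atoms_def)
      then show ?thesis by simp
    qed
    then have "real n \<le> \<bar>of_int k / real (h n)\<bar>" using h_pos[of n] by (simp add: field_simps)
    then show ?thesis using *[of k s] that(2) by linarith
  qed
qed

definition window :: "real \<Rightarrow> nat \<Rightarrow> int set" where
  "window R n = {- \<lceil>(R + 1) * real (h n)\<rceil>..\<lceil>(R + 1) * real (h n)\<rceil>}"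

lemma window: "k \<notin> window R n \<Longrightarrow> \<bar>of_int k\<bar> > (R + 1) * real (h n)" "finite (window R n)"
proof -
  assume "k \<notin> window R n"
  then have "\<bar>k\<bar> > \<lceil>(R + 1) * real (h n)\<rceil>" by (auto simp: window_def)
  then show "\<bar>of_int k\<bar> > (R + 1) * real (h n)" by linarith
qed (simp add: window_def)

definition atom_window :: "real \<Rightarrow> (nat \<times> int \<times> bool) set" where
  "atom_window R = (SIGMA n:{..<nat \<lceil>R\<rceil> + 2}. window R n \<times> UNIV)"

lemma finite_atom_window: "finite (atom_window R)"
  unfolding atom_window_def by (intro finite_SigmaI finite_cartesian_product window(2)) auto

lemma atom_window_far: "R > 0 \<Longrightarrow> i \<in> atoms - atom_window R \<Longrightarrow> \<bar>pos i\<bar> > R"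
proof -
  assume R: "R > 0" and i: "i \<in> atoms - atom_window R"
  obtain n k s where [simp]: "i = (n, k, s)" by (cases i)
  show ?thesis
  proof (cases "n < nat \<lceil>R\<rceil> + 2")
    case True
    then have "k \<notin> window R n" using i by (auto simp: atom_window_def)
    then show ?thesis using pos_far'[OF R window(1)] by simp
  next
    case False
    then have "real n > R + 1" by linarith
    then show ?thesis using pos_far[OF R] i by simp
  qed
qed

lemma locally_finite_atoms: "locally_finite_family atoms pos"
  unfolding locally_finite_family_def
proof (intro allI impI)
  fix B :: "real set" assume "bounded B"
  then obtain R where R: "R > 0" "\<And>x. x \<in> B \<Longrightarrow> \<bar>x\<bar> \<le> R" by (rule bounded_realE) blast
  have "{i \<in> atoms. pos i \<in> B} \<subseteq> atom_window R"
    using atom_window_far[OF R(1)] R(2) by force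
  then show "finite {i \<in> atoms. pos i \<in> B}" using finite_atom_window finite_subset by blast
qed

definition freq_window :: "real \<Rightarrow> (nat \<times> nat \<times> int) set" where
  "freq_window R = (SIGMA n:{..<nat \<lceil>R\<rceil> + 1}. {..<d n} \<times> {- \<lceil>R\<rceil> - 1..\<lceil>R\<rceil> + 1})"

text \<open>
  The frequencies of level \<open>n\<close> lie in \<open>[n, h - n]\<close>, hence their translates by nonzero multiples of \<open>h\<close> also
  keep distance \<open>n\<close> from 0.
\<close>

lemma fpos_lower:
  assumes "j < d n"
  shows "\<bar>fpos (n, j, m)\<bar> \<ge> real n" "\<bar>fpos (n, j, m)\<bar> \<ge> \<bar>of_int m\<bar> - 1"
proof -
  note b = freq_gap[OF assms]
  have h: "real (h n) \<ge> 1" by (rule h_ge_1)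
  consider "m \<ge> 0" | "m \<le> -1" by linarith
  then show "\<bar>fpos (n, j, m)\<bar> \<ge> real n"
  proof cases
    case 1
    then have "real (h n) * of_int m \<ge> 0" by simp
    then show ?thesis using b by (simp add: fpos_def)
  next
    case 2
    then have "real (h n) * of_int m \<le> real (h n) * (-1)" by (intro mult_left_mono) auto
    then show ?thesis using b by (simp add: fpos_def)
  qed
  show "\<bar>fpos (n, j, m)\<bar> \<ge> \<bar>of_int m\<bar> - 1"
  proof (cases "m = 0")
    case False
    then have m: "\<bar>of_int m :: real\<bar> \<ge> 1" by linarith
    have "\<bar>fpos (n, j, m)\<bar> \<ge> real (h n) * \<bar>of_int m\<bar> - real (h n)"
    proof -
      have "\<bar>real (h n) * of_int m\<bar> = real (h n) * \<bar>of_int m\<bar>" by (simp add: abs_mult)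
      then show ?thesis using b h unfolding fpos_def prod.case by linarith
    qed
    also have "real (h n) * \<bar>of_int m\<bar> - real (h n) = real (h n) * (\<bar>of_int m\<bar> - 1)"
      by (simp add: algebra_simps)
    finally show ?thesis using mult_right_mono[OF h, of "\<bar>of_int m\<bar> - 1"] m by simp
  qed simp
qed

lemma finite_freq_window: "finite (freq_window R)"
  unfolding freq_window_def by (intro finite_SigmaI finite_cartesian_product) auto

lemma freq_window_far:
  assumes R: "R > 0" and i: "i \<in> freqs - freq_window R"
  shows "\<bar>fpos i\<bar> > R"
proof -
  obtain n j m where [simp]: "i = (n, j, m)" by (cases i)
  have j: "j < d n" using i by (auto simp: freqs_def)
  show ?thesis
  proof (cases "n < nat \<lceil>R\<rceil> + 1")
    case True
    then have "m \<notin> {- \<lceil>R\<rceil> - 1..\<lceil>R\<rceil> + 1}" using i j by (auto simp: freq_window_def)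
    then have "\<bar>of_int m\<bar> > R + 1" by (auto simp: not_le) linarith+
    then show ?thesis using fpos_lower(2)[OF j, of m] by simp
  next
    case False
    then have "real n > R" by linarith
    then show ?thesis using fpos_lower(1)[OF j, of m] by simp
  qed
qed

lemma locally_finite_freqs: "locally_finite_family freqs fpos"
  unfolding locally_finite_family_def
proof (intro allI impI)
  fix B :: "real set" assume "bounded B"
  then obtain R where R: "R > 0" "\<And>x. x \<in> B \<Longrightarrow> \<bar>x\<bar> \<le> R" by (rule bounded_realE) blast
  have "{i \<in> freqs. fpos i \<in> B} \<subseteq> freq_window R"
    using freq_window_far[OF R(1)] R(2) by force
  then show "finite {i \<in> freqs. fpos i \<in> B}" using finite_freq_window finite_subset by blast
qed

lemma dipole_bound:
  assumes f: "f \<in> schwartz_space"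
  defines "S \<equiv> schwartz_seminorm 0 1 f + schwartz_seminorm 2 1 f"
  shows "norm (dipole n f k) \<le> (1/2) ^ n * (3 * S) * (1 / (1 + (of_int k)\<^sup>2))"
proof -
  let ?x = "of_int k / real (h n)"
  have S: "S \<ge> 0" using schwartz_seminorm_nonneg[OF f] by (simp add: S_def)
  have h: "real (h n) \<ge> 1" by (rule h_ge_1)
  have x: "1 + ?x\<^sup>2 > 0" "1 + (of_int k :: real)\<^sup>2 > 0" by (auto simp: add_pos_nonneg)
  have "norm (f (?x + \<epsilon> n) - f ?x) / \<epsilon> n \<le> 3 * S / (1 + ?x\<^sup>2)"
    using schwartz_increment_bound[OF f \<epsilon>_pos \<epsilon>_le_1, of ?x] \<epsilon>_pos[of n]
    by (simp add: S_def pos_divide_le_eq mult.commute)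
  then have "norm (dipole n f k) \<le> (1/2) ^ n / (real (h n))\<^sup>2 * (3 * S / (1 + ?x\<^sup>2))"
    unfolding dipole_def norm_mult norm_divide norm_of_real
    using amp_bound[of n k] \<epsilon>_pos[of n] S by (intro mult_mono) auto
  also have "\<dots> = (1/2) ^ n * (3 * S) * (1 / ((real (h n))\<^sup>2 * (1 + ?x\<^sup>2)))" by simp
  also have "\<dots> \<le> (1/2) ^ n * (3 * S) * (1 / (1 + (of_int k)\<^sup>2))"
  proof (intro mult_left_mono divide_left_mono)
    have "(real (h n))\<^sup>2 * (1 + ?x\<^sup>2) = (real (h n))\<^sup>2 + (of_int k)\<^sup>2"
      using h by (simp add: field_simps)
    moreover have "(real (h n))\<^sup>2 \<ge> 1" using h by simp
    ultimately show "1 + (of_int k)\<^sup>2 \<le> (real (h n))\<^sup>2 * (1 + ?x\<^sup>2)" by simp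
  qed (use S x h in auto)
  finally show ?thesis .
qed

lemma
  assumes f: "f \<in> schwartz_space"
  defines "S \<equiv> schwartz_seminorm 0 1 f + schwartz_seminorm 2 1 f"
    and "Z \<equiv> (\<Sum>i. 1 / (1 + (real i)\<^sup>2))"
  shows summable_comb: "summable (\<lambda>i. dipole n f (int i) + dipole n f (- int i - 1))"
    and summable_dipole_dist: "summable (\<lambda>n. comb n f)"
    and dipole_dist_bound: "norm (dipole_dist f) \<le> (12 * Z) * S"
proof -
  have S: "S \<ge> 0" using schwartz_seminorm_nonneg[OF f] by (simp add: S_def)
  have Z: "Z \<ge> 0" unfolding Z_def by (intro suminf_nonneg summable_inverse_1_plus_square) (simp add: add_nonneg_nonneg)
  have le: "norm (dipole n f (int i) + dipole n f (- int i - 1)) \<le> ((1/2) ^ n * (6 * S)) * (1 / (1 + (real i)\<^sup>2))" for n i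
  proof -
    have "1 / (1 + (of_int (- int i - 1))\<^sup>2) \<le> 1 / (1 + (real i)\<^sup>2)"
      by (intro divide_left_mono) (auto simp: power2_eq_square algebra_simps add_pos_nonneg)
    then have "(1/2) ^ n * (3 * S) * (1 / (1 + (of_int (- int i - 1))\<^sup>2)) \<le> (1/2) ^ n * (3 * S) * (1 / (1 + (real i)\<^sup>2))"
      using S by (intro mult_left_mono) auto
    moreover note dipole_bound[OF f, of n "- int i - 1", folded S_def]
    moreover have "norm (dipole n f (int i)) \<le> (1/2) ^ n * (3 * S) * (1 / (1 + (real i)\<^sup>2))"
      using dipole_bound[OF f, of n "int i", folded S_def] by simp
    ultimately have "norm (dipole n f (int i)) + norm (dipole n f (- int i - 1)) \<le>
        (1/2) ^ n * (3 * S) * (1 / (1 + (real i)\<^sup>2)) + (1/2) ^ n * (3 * S) * (1 / (1 + (real i)\<^sup>2))"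
      by linarith
    then show ?thesis by (intro order_trans[OF norm_triangle_ineq]) (simp add: mult_ac)
  qed
  have sm: "summable (\<lambda>i. ((1/2) ^ n * (6 * S)) * (1 / (1 + (real i)\<^sup>2)))" for n
    by (intro summable_mult summable_inverse_1_plus_square)
  show "summable (\<lambda>i. dipole n f (int i) + dipole n f (- int i - 1))" for n
    by (rule summable_comparison_test'[OF sm le])
  have comb: "norm (comb n f) \<le> (1/2) ^ n * (6 * S * Z)" for n
  proof -
    have "norm (comb n f) \<le> (\<Sum>i. ((1/2) ^ n * (6 * S)) * (1 / (1 + (real i)\<^sup>2)))"
      unfolding comb_def by (rule norm_suminf_le[OF le sm])
    also have "\<dots> = ((1/2) ^ n * (6 * S)) * Z"
      unfolding Z_def by (rule suminf_mult[OF summable_inverse_1_plus_square])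
    finally show ?thesis by simp
  qed
  have geo: "(\<lambda>n. (1/2) ^ n * (6 * S * Z)) sums (2 * (6 * S * Z))"
    using sums_mult2[OF geometric_sums[of "1/2::real"], of "6 * S * Z"] by simp
  show "summable (\<lambda>n. comb n f)"
    by (rule summable_comparison_test'[OF sums_summable[OF geo] comb])
  have "norm (dipole_dist f) \<le> (\<Sum>n. (1/2) ^ n * (6 * S * Z))"
    unfolding dipole_dist_def by (rule norm_suminf_le[OF comb sums_summable[OF geo]])
  then show "norm (dipole_dist f) \<le> (12 * Z) * S" using sums_unique[OF geo] by (simp add: mult_ac)
qed

lemma temperate_dipole_dist: "temperate_distribution dipole_dist"
proof (rule temperate_distributionI)
  fix f g assume f: "f \<in> schwartz_space" and g: "g \<in> schwartz_space"
  have "comb n (\<lambda>x. f x + g x) = comb n f + comb n g" for n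
  proof -
    have "dipole n (\<lambda>x. f x + g x) k = dipole n f k + dipole n g k" for k
      unfolding dipole_def ring_distribs(1)[symmetric] add_divide_distrib[symmetric] by (simp add: algebra_simps)
    then have "comb n (\<lambda>x. f x + g x) = (\<Sum>i. (dipole n f (int i) + dipole n f (- int i - 1)) +
        (dipole n g (int i) + dipole n g (- int i - 1)))"
      unfolding comb_def by (simp add: algebra_simps)
    then show ?thesis unfolding comb_def using suminf_add[OF summable_comb[OF f] summable_comb[OF g]] by simp
  qed
  then show "dipole_dist (\<lambda>x. f x + g x) = dipole_dist f + dipole_dist g"
    unfolding dipole_dist_def using suminf_add[OF summable_dipole_dist[OF f] summable_dipole_dist[OF g]] by simp
next
  fix c f assume f: "f \<in> schwartz_space"
  have "comb n (\<lambda>x. c * f x) = c * comb n f" for n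
  proof -
    have "dipole n (\<lambda>x. c * f x) k = c * dipole n f k" for k
      unfolding dipole_def right_diff_distrib[symmetric] by simp
    then have "comb n (\<lambda>x. c * f x) = (\<Sum>i. c * (dipole n f (int i) + dipole n f (- int i - 1)))"
      unfolding comb_def by (simp add: algebra_simps)
    then show ?thesis unfolding comb_def using suminf_mult[OF summable_comb[OF f], of c n] by simp
  qed
  then show "dipole_dist (\<lambda>x. c * f x) = c * dipole_dist f"
    unfolding dipole_dist_def using suminf_mult[OF summable_dipole_dist[OF f], of c] by simp
next
  show "norm (dipole_dist f) \<le> (12 * (\<Sum>i. 1 / (1 + (real i)\<^sup>2))) * (schwartz_seminorm 0 1 f + schwartz_seminorm 2 1 f)"
    if "f \<in> schwartz_space" for f
    using dipole_dist_bound[OF that] .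
qed

lemma given_by_measure_dipole_dist: "given_by_measure dipole_dist (family_measure atoms pos wt)"
  unfolding given_by_measure_def
proof
  fix \<phi> assume \<phi>: "\<phi> \<in> test_functions"
  obtain R where R: "R > 0" "\<And>x. \<bar>x\<bar> > R \<Longrightarrow> \<phi> x = 0" by (rule test_functions_supportE[OF \<phi>]) blast
  let ?N = "nat \<lceil>R\<rceil> + 2"
  have dip: "dipole n \<phi> k = (\<Sum>s\<in>UNIV. wt (n, k, s) * \<phi> (pos (n, k, s)))" for n k
    by (simp add: dipole_def wt_def pos_def UNIV_bool diff_divide_distrib right_diff_distrib)
  have far0: "\<phi> (pos (n, k, s)) = 0" if "\<bar>pos (n, k, s)\<bar> > R" for n k s using R(2) that .
  have comb: "comb n \<phi> = (\<Sum>k\<in>window R n. dipole n \<phi> k)" for n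
  proof -
    have "dipole n \<phi> k = 0" if "k \<notin> window R n" for k
      unfolding dip using pos_far'[OF R(1) window(1)[OF that]] far0 by simp
    from sums_int_finite[of "window R n" "dipole n \<phi>", OF window(2) this] show ?thesis
      unfolding comb_def by (simp add: sums_iff)
  qed
  have "comb n \<phi> = 0" if "n \<notin> {..<?N}" for n
  proof -
    have n: "real n > R + 1" using that by simp linarith
    have "dipole n \<phi> k = 0" for k
    proof (cases "\<bar>k\<bar> \<ge> int n * int (h n)")
      case True
      then show ?thesis unfolding dip using pos_far[OF R(1) _ n] far0 by (simp add: atoms_def)
    next
      case False
      then show ?thesis by (simp add: dipole_def amp_gap)
    qed
    then show ?thesis by (simp add: comb)
  qed
  then have "dipole_dist \<phi> = (\<Sum>n<?N. comb n \<phi>)"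
    unfolding dipole_dist_def by (intro suminf_finite) auto
  also have "\<dots> = (\<Sum>n<?N. \<Sum>k\<in>window R n. \<Sum>s\<in>UNIV. wt (n, k, s) * \<phi> (pos (n, k, s)))"
    by (simp only: comb dip)
  also have "\<dots> = (\<Sum>n<?N. \<Sum>ks\<in>window R n \<times> UNIV. wt (n, ks) * \<phi> (pos (n, ks)))"
    by (simp add: sum.cartesian_product)
  also have "\<dots> = (\<Sum>i\<in>atom_window R. wt i * \<phi> (pos i))"
    unfolding atom_window_def by (subst sum.Sigma) (auto intro: window(2))
  also have "\<dots> = complex_integral (family_measure atoms pos wt) \<phi>"
  proof (rule complex_integral_family[OF locally_finite_atoms, symmetric])
    show "\<phi> \<in> borel_measurable borel"
      by (intro borel_measurable_continuous_onI continuous_on_smooth test_functions_smooth \<phi>)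
    show "wt i = 0" if "i \<in> atom_window R - atoms" for i
      using that by (cases i) (auto simp: atoms_def wt_def amp_gap)
  qed (use finite_atom_window atom_window_far[OF R(1)] R(2) in auto)
  finally show "dipole_dist \<phi> = complex_integral (family_measure atoms pos wt) \<phi>" .
qed

text \<open>
  Differences of a Fourier transform are the Fourier transform of a product with
  \<open>e\<^sup>-\<^sup>2\<^sup>\<pi>\<^sup>i\<^sup>\<epsilon>\<^sup>y - 1\<close>. Expanding the amplitude into exponentials therefore reduces the claim to one Poisson
  formula for each frequency.
\<close>

lemma comb_fourier:
  assumes \<phi>: "\<phi> \<in> test_functions" and R: "R > 0" "\<And>x. \<bar>x\<bar> > R \<Longrightarrow> \<phi> x = 0"
    and F: "finite F" "\<And>j m. j < d n \<Longrightarrow> m \<notin> F \<Longrightarrow> \<phi> (fpos (n, j, m)) = 0"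
  shows "comb n (fourier \<phi>) = (\<Sum>j<d n. \<Sum>m\<in>F. fwt (n, j, m) * \<phi> (fpos (n, j, m)))"
proof -
  define \<psi> where "\<psi> y = \<phi> y * (char_e (- \<epsilon> n * y) - 1) / of_real (\<epsilon> n)" for y
  define t where "t j k = char_e (\<beta> n j * (of_int k / h n)) * fourier \<psi> (of_int k / h n)" for j and k :: int
  have dip: "dipole n (fourier \<phi>) k = (\<Sum>j<d n. q n j * t j k)" for k
  proof -
    have "(fourier \<phi> (of_int k / h n + \<epsilon> n) - fourier \<phi> (of_int k / h n)) / of_real (\<epsilon> n) = fourier \<psi> (of_int k / h n)"
      unfolding fourier_increment[OF \<phi>] \<psi>_def by (simp add: fourier_divide)
    then show ?thesis
      unfolding dipole_def by (simp add: amp_def trig_poly_def t_def sum_distrib_right mult.assoc)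
  qed
  obtain L where L: "\<And>x y. norm (\<psi> x - \<psi> y) \<le> L * \<bar>x - y\<bar>"
    unfolding \<psi>_def by (rule test_function_mult_lipschitz[OF \<phi>]) blast
  have "(\<lambda>i. \<Sum>j<d n. q n j * (t j (int i) + t j (- int i - 1))) sums
      (\<Sum>j<d n. q n j * (real (h n) * (\<Sum>m\<in>F. \<psi> (\<beta> n j + real (h n) * of_int m))))"
  proof (intro sums_sum sums_mult)
    fix j assume "j \<in> {..<d n}"
    then have j: "j < d n" by simp
    show "(\<lambda>i. t j (int i) + t j (- int i - 1)) sums (real (h n) * (\<Sum>m\<in>F. \<psi> (\<beta> n j + real (h n) * of_int m)))"
      unfolding t_def
    proof (rule poisson_summation_shifted[OF _ L _ F(1)])
      show "\<psi> x = 0" if "\<bar>x\<bar> > R" for x using R(2)[OF that] by (simp add: \<psi>_def)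
      show "\<psi> (\<beta> n j + real (h n) * of_int m) = 0" if "m \<notin> F" for m
        using F(2)[OF j that] by (simp add: \<psi>_def fpos_def)
    qed (use h_pos in simp)
  qed
  then have "comb n (fourier \<phi>) = (\<Sum>j<d n. q n j * (real (h n) * (\<Sum>m\<in>F. \<psi> (\<beta> n j + real (h n) * of_int m))))"
    unfolding comb_def dip by (simp add: sums_iff ring_distribs sum.distrib)
  also have "\<dots> = (\<Sum>j<d n. \<Sum>m\<in>F. fwt (n, j, m) * \<phi> (fpos (n, j, m)))"
    unfolding sum_distrib_left by (intro sum.cong refl) (simp add: fwt_def fpos_def \<psi>_def)
  finally show ?thesis .
qed

lemma given_by_measure_fourier_dipole_dist:
  "given_by_measure (fourier_distribution dipole_dist) (family_measure freqs fpos fwt)"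
  unfolding given_by_measure_def fourier_distribution_def
proof
  fix \<phi> assume \<phi>: "\<phi> \<in> test_functions"
  obtain R where R: "R > 0" "\<And>x. \<bar>x\<bar> > R \<Longrightarrow> \<phi> x = 0" by (rule test_functions_supportE[OF \<phi>]) blast
  let ?N = "nat \<lceil>R\<rceil> + 1" and ?F = "{- \<lceil>R\<rceil> - 1..\<lceil>R\<rceil> + 1}"
  have far0: "\<phi> (fpos i) = 0" if "i \<in> freqs - freq_window R" for i
    using R(2) freq_window_far[OF R(1) that] .
  have comb: "comb n (fourier \<phi>) = (\<Sum>j<d n. \<Sum>m\<in>?F. fwt (n, j, m) * \<phi> (fpos (n, j, m)))" for n
    by (rule comb_fourier[OF \<phi> R]) (auto intro!: far0 simp: freqs_def freq_window_def)
  have "comb n (fourier \<phi>) = 0" if "n \<notin> {..<?N}" for n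
    unfolding comb using that by (intro sum.neutral ballI) (auto intro!: far0 simp: freqs_def freq_window_def)
  then have "dipole_dist (fourier \<phi>) = (\<Sum>n<?N. comb n (fourier \<phi>))"
    unfolding dipole_dist_def by (intro suminf_finite) auto
  also have "\<dots> = (\<Sum>n<?N. \<Sum>jm\<in>{..<d n} \<times> ?F. fwt (n, jm) * \<phi> (fpos (n, jm)))"
    by (simp add: comb sum.cartesian_product)
  also have "\<dots> = (\<Sum>i\<in>freq_window R. fwt i * \<phi> (fpos i))"
    unfolding freq_window_def by (subst sum.Sigma) auto
  also have "\<dots> = complex_integral (family_measure freqs fpos fwt) \<phi>"
  proof (rule complex_integral_family[OF locally_finite_freqs, symmetric])
    show "\<phi> \<in> borel_measurable borel"
      by (intro borel_measurable_continuous_onI continuous_on_smooth test_functions_smooth \<phi>)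
    show "fwt i = 0" if "i \<in> freq_window R - freqs" for i
      using that by (auto simp: freqs_def freq_window_def)
  qed (use finite_freq_window far0 in auto)
  finally show "dipole_dist (fourier \<phi>) = complex_integral (family_measure freqs fpos fwt) \<phi>" .
qed

lemma crystalline_dipole_combs: "crystalline (family_measure atoms pos wt)"
proof -
  note \<mu> = atomic_family_measure[OF locally_finite_atoms, of wt]
  note \<nu> = atomic_family_measure[OF locally_finite_freqs, of fwt]
  have "fourier_measure (family_measure atoms pos wt) (family_measure freqs fpos fwt)"
    unfolding fourier_measure_def
    using complex_measure_atomic[OF \<mu>] complex_measure_atomic[OF \<nu>] temperate_dipole_dist
      given_by_measure_dipole_dist given_by_measure_fourier_dipole_dist by blast
  then show ?thesis
    unfolding crystalline_def
    using complex_measure_atomic[OF \<mu>] discrete_supp_atomic[OF \<mu>] discrete_supp_atomic[OF \<nu>] by blast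
qed

text \<open>
  All other atoms are rational, or differ from a rational by some \<open>\<epsilon> m\<close> with \<open>m \<noteq> n\<close>, or are displaced
  from another lattice point of level \<open>n\<close>; so none meets \<open>n + \<epsilon> n\<close>.
\<close>

lemma family_mass_big:
  "norm (family_mass atoms pos wt (real n + \<epsilon> n)) = norm (amp n (int n * int (h n))) / \<epsilon> n"
proof -
  let ?i = "(n, int n * int (h n), True)"
  have "{i \<in> atoms. pos i = real n + \<epsilon> n} = {?i}"
  proof (intro equalityI subsetI)
    fix i assume i: "i \<in> {i \<in> atoms. pos i = real n + \<epsilon> n}"
    obtain m k s where mks [simp]: "i = (m, k, s)" by (cases i)
    have eq: "of_int k / real (h m) + (if s then \<epsilon> m else 0) = real n + \<epsilon> n"
      using i by (simp add: pos_def)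
    have rat: "of_int k / real (h m) - real n \<in> \<rat>" "real n - of_int k / real (h m) \<in> \<rat>" by auto
    have s
    proof (rule ccontr)
      assume "\<not> s"
      then have "\<epsilon> n = of_int k / real (h m) - real n" using eq by simp
      then show False using rat(1) \<epsilon>_irrational(1)[of n] by simp
    qed
    moreover have "m = n"
    proof (rule ccontr)
      assume "m \<noteq> n"
      have "\<epsilon> m - \<epsilon> n = real n - of_int k / real (h m)" using eq \<open>s\<close> by simp
      then show False using rat(2) \<epsilon>_irrational(2)[OF \<open>m \<noteq> n\<close>] by simp
    qed
    moreover have "k = int n * int (h n)"
    proof -
      have "of_int k / real (h n) = real n" using eq \<open>s\<close> \<open>m = n\<close> by simp
      then have "real_of_int k = real_of_int (int n * int (h n))" using h_pos[of n] by (simp add: field_simps)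
      then show ?thesis by (simp only: of_int_eq_iff)
    qed
    ultimately show "i \<in> {?i}" by simp
  qed (use h_pos[of n] in \<open>auto simp: atoms_def pos_def\<close>)
  then show ?thesis using \<epsilon>_pos[of n] by (simp add: family_mass_def wt_def norm_divide)
qed

text \<open>
  A temperate functional grows at most polynomially on the translates of a bump to \<open>n + \<epsilon> n\<close>: their
  seminorms of order up to \<open>J\<close> are at most a constant times \<open>(n + 2)\<^sup>J\<close>. The atom there forces the value
  \<open>n (n + 2)\<^sup>n e\<^sup>-\<^sup>1\<close> or more.
\<close>

lemma not_quasicrystal_dipole_combs: "\<not> temperate_measure (abs_measure (family_measure atoms pos wt))"
proof
  let ?\<mu> = "family_measure atoms pos wt" and ?c = "family_mass atoms pos wt"
  note \<mu> = atomic_family_measure[OF locally_finite_atoms, of wt]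
  assume "temperate_measure (abs_measure ?\<mu>)"
  then obtain T where T: "temperate_distribution T" "given_by_measure T (abs_measure ?\<mu>)"
    by (auto simp: temperate_measure_def)
  obtain J C where C: "C > 0" "\<And>f B. f \<in> schwartz_space \<Longrightarrow> B > 0 \<Longrightarrow>
    (\<And>j k. j \<le> J \<Longrightarrow> k \<le> J \<Longrightarrow> schwartz_seminorm j k f \<le> B) \<Longrightarrow> norm (T f) \<le> C * B"
    by (rule temperate_distribution_bound[OF T(1)]) blast
  have bump_s: "bump \<in> schwartz_space" using bump_test test_functions_subset_schwartz by auto
  define M where "M = 1 + (\<Sum>k\<le>J. schwartz_seminorm 0 k bump)"
  have M: "M > 0" unfolding M_def by (intro add_pos_nonneg sum_nonneg schwartz_seminorm_nonneg bump_s) auto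
  have bump_M: "norm (nth_derivative k bump x) \<le> M" if "k \<le> J" for k x
  proof -
    have "norm (nth_derivative k bump x) \<le> schwartz_seminorm 0 k bump"
      using schwartz_seminorm_upper[OF bump_s, of x 0 k] by simp
    also have "\<dots> \<le> (\<Sum>k\<le>J. schwartz_seminorm 0 k bump)"
      using that by (intro member_le_sum schwartz_seminorm_nonneg bump_s) auto
    finally show ?thesis by (simp add: M_def)
  qed
  have key: "real n * exp (- 1) \<le> C * M" if "n \<ge> J" for n
  proof -
    define x where "x = real n + \<epsilon> n"
    have x: "x > 0" "x + 1 \<le> real n + 2" using \<epsilon>_pos[of n] \<epsilon>_le_1[of n] by (auto simp: x_def)
    let ?f = "\<lambda>y. bump (y - x)"
    have supp: "?f y = 0" if "\<bar>y\<bar> > x + 1" for y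
    proof -
      have "\<not> \<bar>y - x\<bar> < 1" using that x by linarith
      then show ?thesis by (simp add: bump_def bump_form_def)
    qed
    have f: "?f \<in> test_functions"
    proof -
      have "{y. ?f y \<noteq> 0} \<subseteq> {-(x+1)..x+1}" using supp by (force simp: abs_le_iff not_less[symmetric])
      then have "closure {y. ?f y \<noteq> 0} \<subseteq> {-(x+1)..x+1}" by (simp add: closure_minimal)
      then have "compact (closure {y. ?f y \<noteq> 0})"
        by (meson bounded_closed_interval bounded_subset closed_closure compact_eq_bounded_closed)
      then show ?thesis by (simp add: test_functions_def smooth_function_shift smooth_bump)
    qed
    then have fs: "?f \<in> schwartz_space" using test_functions_subset_schwartz by auto
    let ?F = "pos ` atoms \<inter> {-(x+1)..x+1}"
    have F: "finite ?F" using atomic_onD(4)[OF \<mu>, of "{-(x+1)..x+1}"] by simp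
    have "T ?f = (\<Sum>y\<in>?F. of_real (norm (?c y)) * ?f y)"
    proof -
      have "T ?f = complex_integral (abs_measure ?\<mu>) ?f" using T(2) f by (auto simp: given_by_measure_def)
      also have "\<dots> = (\<Sum>y\<in>?F. of_real (norm (?c y)) * ?f y)"
        using F supp by (intro complex_integral_atomic[OF abs_measure_atomic[OF \<mu>]] borel_measurable_continuous_onI
            continuous_on_smooth test_functions_smooth f) (force simp: abs_le_iff not_less[symmetric])+
      finally show ?thesis .
    qed
    also have "\<dots> = of_real (\<Sum>y\<in>?F. norm (?c y) * bump_form 1 0 (y - x))" by (simp add: bump_def)
    finally have T_eq: "norm (T ?f) = \<bar>\<Sum>y\<in>?F. norm (?c y) * bump_form 1 0 (y - x)\<bar>" by (simp only: norm_of_real)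
    have nonneg: "norm (?c y) * bump_form 1 0 (y - x) \<ge> 0" for y by (simp add: bump_form_def)
    have "real n * (real n + 2) ^ n * exp (- 1) \<le> norm (?c x) * bump_form 1 0 (x - x)"
      using mult_right_mono[OF big_amp[of n], of "exp (- 1)"] by (simp add: bump_form_def x_def family_mass_big)
    also have "\<dots> \<le> (\<Sum>y\<in>?F. norm (?c y) * bump_form 1 0 (y - x))"
    proof (rule member_le_sum[OF _ nonneg F])
      have "pos (n, int n * int (h n), True) = x" "(n, int n * int (h n), True) \<in> atoms"
        using h_pos[of n] by (auto simp: pos_def atoms_def x_def)
      then show "x \<in> ?F" using x by auto
    qed
    also have "\<dots> \<le> norm (T ?f)" unfolding T_eq by simp
    also have "\<dots> \<le> C * ((real n + 2) ^ n * M)"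
    proof (rule C(2)[OF fs])
      fix j k assume "j \<le> J" "k \<le> J"
      show "schwartz_seminorm j k ?f \<le> (real n + 2) ^ n * M"
      proof (rule schwartz_seminorm_least)
        fix y
        show "norm (y ^ j *\<^sub>R nth_derivative k ?f y) \<le> (real n + 2) ^ n * M"
        proof (cases "\<bar>y\<bar> > x + 1")
          case True
          then show ?thesis using nth_derivative_eq_0[of "x + 1" ?f y k, OF supp] M by simp
        next
          case False
          have "\<bar>y\<bar> ^ j \<le> (real n + 2) ^ j" using False x by (intro power_mono) auto
          also have "\<dots> \<le> (real n + 2) ^ n" using \<open>j \<le> J\<close> that by (intro power_increasing) auto
          finally have "\<bar>y\<bar> ^ j * norm (nth_derivative k bump (y - x)) \<le> (real n + 2) ^ n * M"
            using bump_M[OF \<open>k \<le> J\<close>] by (intro mult_mono) auto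
          then show ?thesis
            by (simp add: nth_derivative_shift[OF smooth_bump] power_abs)
        qed
      qed
    qed (use M in simp)
    finally have "(real n + 2) ^ n * (real n * exp (- 1)) \<le> (real n + 2) ^ n * (C * M)"
      by (simp add: mult_ac)
    then show ?thesis by (rule mult_left_le_imp_le) simp
  qed
  obtain n where n: "real n > C * M / exp (- 1)" using reals_Archimedean2 by blast
  then have "C * M < real n * exp (- 1)" by (simp add: pos_divide_less_eq)
  also have "\<dots> \<le> real (max n J) * exp (- 1)" by (intro mult_right_mono) auto
  finally show False using key[of "max n J"] by linarith
qed

end

section \<open>Choice of the parameters\<close>

lemma norm_trig_poly_le: "norm (trig_poly d q \<beta> x) \<le> (\<Sum>j<d. norm (q j))"
  unfolding trig_poly_def by (rule sum_norm_le) (simp add: norm_mult)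

lemma trig_poly_scale: "trig_poly d (\<lambda>j. c * q j) \<beta> x = c * trig_poly d q \<beta> x"
  by (simp add: trig_poly_def sum_distrib_left mult.assoc)

text \<open>
  The interval \<open>(-n, n)\<close> contains \<open>8 n\<^sup>2 - 1\<close> points of the lattice \<open>\<int> / (4 n)\<close>, so the polynomial with the
  corresponding zeros has \<open>8 n\<^sup>2\<close> coefficients. Frequency steps of \<open>1 / (8 n)\<close> fit all of them into
  \<open>[n, 2 n]\<close>, well inside \<open>[n, h - n]\<close>. At the same time the sum has the period \<open>8 n\<close>, long
  enough for the zeros not to recur at the point \<open>n\<close>.
\<close>

lemma gapped_trig_poly_exists:
  assumes n: "n \<ge> 1"
  defines "h \<equiv> 4 * n" and "d \<equiv> 8 * n\<^sup>2" and "\<beta> \<equiv> \<lambda>j. real n + real j / (8 * real n)"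
  obtains q where "\<And>k. \<bar>k\<bar> < int n * int h \<Longrightarrow> trig_poly d q \<beta> (of_int k / h) = 0"
    and "trig_poly d q \<beta> n \<noteq> 0"
proof -
  define z where "z k = char_e (of_int k / (32 * (real n)\<^sup>2))" for k :: int
  define A where "A = {- (4 * int (n\<^sup>2) - 1)..4 * int (n\<^sup>2) - 1}"
  define P where "P = (\<Prod>k\<in>A. [:- z k, 1:])"
  have n2: "n\<^sup>2 \<ge> 1" using n by simp
  have deg: "degree P < d"
  proof -
    have "degree P \<le> (\<Sum>k\<in>A. degree [:- z k, 1:])"
      unfolding P_def by (rule degree_prod_sum_le[unfolded o_def]) (simp add: A_def)
    also have "\<dots> = card A" by simp
    also have "\<dots> = nat (8 * int (n\<^sup>2) - 1)" by (simp add: A_def)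
    also have "\<dots> < d" using n2 unfolding d_def by linarith
    finally show ?thesis .
  qed
  \<comment> \<open>at lattice points the exponential sum is, up to a phase, a polynomial in one root of unity\<close>
  have tp: "trig_poly d (coeff P) \<beta> (of_int k / h) = char_e (of_int k / 4) * poly P (z k)" for k
  proof -
    have "char_e (\<beta> j * (of_int k / h)) = char_e (of_int k / 4) * z k ^ j" for j
    proof -
      have "\<beta> j * (of_int k / h) = of_int k / 4 + real j * (of_int k / (32 * (real n)\<^sup>2))"
        using n by (simp add: \<beta>_def h_def field_simps power2_eq_square)
      then show ?thesis by (simp only: char_e_add z_def char_e_power)
    qed
    then have "trig_poly d (coeff P) \<beta> (of_int k / h) = char_e (of_int k / 4) * (\<Sum>j<d. coeff P j * z k ^ j)"
      unfolding trig_poly_def sum_distrib_left by (intro sum.cong refl) simp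
    also have "(\<Sum>j<d. coeff P j * z k ^ j) = poly P (z k)"
      unfolding poly_altdef using deg by (intro sum.mono_neutral_right) (auto simp: coeff_eq_0)
    finally show ?thesis .
  qed
  show thesis
  proof (rule that[of "coeff P"])
    fix k assume "\<bar>k\<bar> < int n * int h"
    then have "k \<in> A" by (auto simp: A_def h_def power2_eq_square)
    then have "poly P (z k) = 0" unfolding P_def poly_prod by (intro prod_zero bexI[of _ k]) (auto simp: A_def)
    then show "trig_poly d (coeff P) \<beta> (of_int k / h) = 0" by (simp add: tp)
  next
    let ?k = "4 * int (n\<^sup>2)"
    have "z ?k \<noteq> z k" if "k \<in> A" for k
    proof
      assume eq: "z ?k = z k"
      define w where "w = real_of_int (?k - k)"
      define c where "c = 32 * (real n)\<^sup>2"
      have c: "c > 0" using n by (simp add: c_def)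
      have "1 \<le> ?k - k" "?k - k \<le> 8 * int (n\<^sup>2)" using that by (auto simp: A_def)
      then have "1 \<le> w" "w \<le> real_of_int (8 * int (n\<^sup>2))"
        unfolding w_def by (linarith, simp only: of_int_le_iff)
      then have "1 \<le> w" "w \<le> c / 4" by (simp_all add: c_def)
      then have x: "0 < w / c" "w / c \<le> 1/4" using c by (simp_all add: pos_divide_le_eq)
      have "of_int ?k / c = w / c + of_int k / c"
        unfolding add_divide_distrib[symmetric] w_def by simp
      then have "z ?k = char_e (w / c) * z k" unfolding z_def c_def by (simp only: char_e_add)
      then have "char_e (w / c) = 1" using eq by (simp add: z_def)
      then show False using norm_char_e_minus_1_ge[of "w / c"] x by simp
    qed
    then have "poly P (z ?k) \<noteq> 0" unfolding P_def poly_prod by (auto simp: A_def prod_zero_iff)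
    moreover have "of_int ?k / real h = real n" using n by (simp add: h_def power2_eq_square)
    ultimately show "trig_poly d (coeff P) \<beta> n \<noteq> 0" using tp[of ?k] by simp
  qed
qed

definition gapped_level :: "nat \<Rightarrow> nat \<Rightarrow> nat \<Rightarrow> (nat \<Rightarrow> complex) \<Rightarrow> (nat \<Rightarrow> real) \<Rightarrow> bool" where
  "gapped_level n h d q \<beta> \<longleftrightarrow> h > 0 \<and> (\<forall>j<d. real n \<le> \<beta> j \<and> \<beta> j \<le> real h - real n) \<and>
     (\<forall>k::int. \<bar>k\<bar> < int n * int h \<longrightarrow> trig_poly d q \<beta> (of_int k / h) = 0) \<and>
     (\<forall>x. norm (trig_poly d q \<beta> x) \<le> (1/2) ^ n / (real h)\<^sup>2) \<and>
     (n \<ge> 1 \<longrightarrow> trig_poly d q \<beta> n \<noteq> 0)"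

text \<open>
  Rescaling the coefficients achieves any bound and keeps the zeros. Level 0 is empty.
\<close>

lemma gapped_level_exists: "\<exists>h d q \<beta>. gapped_level n h d q \<beta>"
proof (cases "n \<ge> 1")
  case False
  then have "gapped_level n 1 0 (\<lambda>_. 0) (\<lambda>_. 0)" by (simp add: gapped_level_def trig_poly_def)
  then show ?thesis by blast
next
  case True
  define h where "h = 4 * n"
  define d where "d = 8 * n\<^sup>2"
  define \<beta> where "\<beta> = (\<lambda>j. real n + real j / (8 * real n))"
  obtain q where q: "\<And>k. \<bar>k\<bar> < int n * int h \<Longrightarrow> trig_poly d q \<beta> (of_int k / h) = 0"
    "trig_poly d q \<beta> n \<noteq> 0"
    using gapped_trig_poly_exists[OF True] unfolding h_def d_def \<beta>_def by blast
  define S where "S = (\<Sum>j<d. norm (q j))"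
  have S: "S > 0" using norm_trig_poly_le[of d q \<beta> n] q(2) unfolding S_def[symmetric]
    by (smt (verit) zero_less_norm_iff)
  define c where "c = (1/2) ^ n / (real h)\<^sup>2 / S"
  have h: "h > 0" using True by (simp add: h_def)
  then have c: "c > 0" using S by (simp add: c_def)
  have b: "real n \<le> \<beta> j \<and> \<beta> j \<le> real h - real n" if "j < d" for j
  proof -
    have "real j \<le> 8 * (real n)\<^sup>2" using that unfolding d_def by (metis less_imp_le of_nat_le_iff of_nat_mult of_nat_numeral of_nat_power)
    then have "real j / (8 * real n) \<le> real n" using True by (simp add: field_simps power2_eq_square)
    then show ?thesis by (simp add: \<beta>_def h_def)
  qed
  have "norm (trig_poly d (\<lambda>j. of_real c * q j) \<beta> x) \<le> (1/2) ^ n / (real h)\<^sup>2" for x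
  proof -
    have "norm (trig_poly d (\<lambda>j. of_real c * q j) \<beta> x) = c * norm (trig_poly d q \<beta> x)"
      using c by (simp add: trig_poly_scale norm_mult)
    also have "\<dots> \<le> c * S" unfolding S_def using c by (intro mult_left_mono norm_trig_poly_le) auto
    finally show ?thesis using S by (simp add: c_def)
  qed
  then have "gapped_level n h d (\<lambda>j. of_real c * q j) \<beta>"
    unfolding gapped_level_def using h b q c by (simp add: trig_poly_scale)
  then show ?thesis by blast
qed

text \<open>
  The scales \<open>s / K n\<close> with a fixed irrational \<open>s\<close> and distinct integers \<open>K n\<close> are as small as desired
  and have irrational differences. Summing the required lower bounds makes \<open>K\<close> strictly increasing.
\<close>

lemma incommensurable_scales_exist:
  fixes b :: "nat \<Rightarrow> real"
  obtains \<epsilon> :: "nat \<Rightarrow> real" where "\<And>n. 0 < \<epsilon> n" "\<And>n. \<epsilon> n \<le> 1" "\<And>n. b n \<le> 1 / \<epsilon> n"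
    "\<And>n. \<epsilon> n \<notin> \<rat>" "\<And>m n. m \<noteq> n \<Longrightarrow> \<epsilon> m - \<epsilon> n \<notin> \<rat>"
proof -
  have "\<not> {0<..<1::real} \<subseteq> \<rat>"
    using countable_rat countable_subset uncountable_open_interval[of 0 "1::real"] by auto
  then obtain s :: real where "s \<in> {0<..<1}" "s \<notin> \<rat>" by blast
  then have s: "0 < s" "s < 1" "s \<notin> \<rat>" by auto
  define K where "K n = (\<Sum>i\<le>n. Suc (nat \<lceil>b i\<rceil>))" for n
  have K: "K n \<ge> Suc (nat \<lceil>b n\<rceil>)" for n
    unfolding K_def by (rule member_le_sum) auto
  have "strict_mono K" by (rule strict_monoI_Suc) (simp add: K_def)
  then have inj: "K m \<noteq> K n" if "m \<noteq> n" for m n using that by (simp add: strict_mono_eq)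
  have K1: "real (K n) \<ge> 1" "real (K n) \<ge> b n" for n using K[of n] by linarith+
  have sr: "s * r \<notin> \<rat>" if "r \<in> \<rat>" "r \<noteq> 0" for r
  proof
    assume "s * r \<in> \<rat>"
    then have "s * r / r \<in> \<rat>" using that(1) by (rule Rats_divide)
    then show False using s(3) that(2) by simp
  qed
  show thesis
  proof (rule that[of "\<lambda>n. s * (1 / real (K n))"])
    fix n
    show "0 < s * (1 / real (K n))" using s K1(1)[of n] by simp
    show "s * (1 / real (K n)) \<le> 1" using s K1(1)[of n] by simp
    show "b n \<le> 1 / (s * (1 / real (K n)))"
    proof -
      have "real (K n) * s \<le> real (K n) * 1" using s K1(1)[of n] by (intro mult_left_mono) auto
      then have "real (K n) \<le> real (K n) / s" using s by (simp add: pos_le_divide_eq)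
      then show ?thesis using K1(2)[of n] by simp
    qed
    show "s * (1 / real (K n)) \<notin> \<rat>" using K1(1)[of n] by (intro sr) auto
    fix m assume "m \<noteq> n"
    then have "s * (1 / real (K m) - 1 / real (K n)) \<notin> \<rat>"
      using K1(1)[of n] K1(1)[of m] inj[of m n] by (intro sr) (auto simp: field_simps)
    then show "s * (1 / real (K m)) - s * (1 / real (K n)) \<notin> \<rat>" by (simp add: right_diff_distrib)
  qed
qed

theorem mainTheorem1:
  shows "\<exists>\<mu>. crystalline \<mu> \<and> \<not> fourier_quasicrystal \<mu>"
proof -
  obtain h d q \<beta> where L: "\<And>n. gapped_level n (h n) (d n) (q n) (\<beta> n)"
    using gapped_level_exists by metis
  define A where "A n = norm (trig_poly (d n) (q n) (\<beta> n) (real n))" for n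
  obtain \<epsilon> :: "nat \<Rightarrow> real" where \<epsilon>: "\<And>n. 0 < \<epsilon> n" "\<And>n. \<epsilon> n \<le> 1"
    "\<And>n. real n * (real n + 2) ^ n / A n \<le> 1 / \<epsilon> n"
    "\<And>n. \<epsilon> n \<notin> \<rat>" "\<And>m n. m \<noteq> n \<Longrightarrow> \<epsilon> m - \<epsilon> n \<notin> \<rat>"
    by (rule incommensurable_scales_exist[of "\<lambda>n. real n * (real n + 2) ^ n / A n"]) blast
  have h: "h n > 0" for n using L[of n] by (simp add: gapped_level_def)
  interpret dipole_combs h d q \<beta> \<epsilon> "\<lambda>n k. trig_poly (d n) (q n) (\<beta> n) (of_int k / h n)"
  proof unfold_locales
    fix n
    show "real n * (real n + 2) ^ n \<le> norm (trig_poly (d n) (q n) (\<beta> n) (of_int (int n * int (h n)) / h n)) / \<epsilon> n"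
    proof (cases "n \<ge> 1")
      case True
      then have "A n > 0" using L[of n] by (simp add: gapped_level_def A_def)
      moreover have "of_int (int n * int (h n)) / real (h n) = real n" using h[of n] by simp
      ultimately show ?thesis using \<epsilon>(3)[of n] \<epsilon>(1)[of n] by (simp add: A_def field_simps)
    next
      case False
      then have "n = 0" by simp
      then show ?thesis using \<epsilon>(1)[of n] by simp
    qed
  qed (use L \<epsilon> in \<open>auto simp: gapped_level_def\<close>)
  show ?thesis
    using crystalline_dipole_combs not_quasicrystal_dipole_combs unfolding fourier_quasicrystal_def by blast
qed

end
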